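(* Let $CP_3(n)$ be defined by $\sum_{n\ge 0} CP_3(n)q^n = \dfrac{f_3^6f_6^6}{f_1^2f_2^2}$. Then for all integers $n\ge 0$, \[ CP_3(24n+7)\equiv 0\pmod{16},\quad CP_3(24n+13)\equiv 0\pmod{4},\quad CP_3(24n+19)\equiv 0\pmod{8}. \]
   Context: For $|q|<1$ and integer $m\ge 1$, $f_m := (q^m;q^m)_\infty=\prod_{n\ge1}(1-q^{mn})$. $CP_3(n)$ is the number of $3$-core cubic bipartitions of $n$, defined by the generating function $\sum_{n\ge0}CP_3(n)q^n = \frac{f_3^6f_6^6}{f_1^2f_2^2}$. *)

theory Defs
  imports "HOL-Analysis.Analysis" "HOL-Number_Theory.Number_Theory"
begin

text \<open>
  The product \<open>f\<^sub>m = (q\<^sup>m; q\<^sup>m)\<^sub>\<infinity>\<close> as a function of the nome \<open>q\<close>. It is meant for \<open>m \<ge> 1\<close> and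
  \<open>norm q < 1\<close>; there the product converges and is nonzero. Infinite products in the library are
  indexed from \<open>0\<close>, hence the shift.
\<close>

definition qf :: "nat \<Rightarrow> complex \<Rightarrow> complex" where
  "qf m q = (\<Prod>n. 1 - q ^ (m * Suc n))"

end

theory Submission
  imports Defs "HOL-Computational_Algebra.Formal_Laurent_Series"
begin

unbundle no vec_syntax
unbundle fps_syntax

text \<open>
  Schroeter's method applied to the Jacobi triple product gives the 2-dissection
  \<open>f\<^sub>3\<^sup>3 / f\<^sub>1 = f\<^sub>4\<^sup>3 f\<^sub>6\<^sup>2 / (f\<^sub>2\<^sup>2 f\<^sub>1\<^sub>2) + q f\<^sub>1\<^sub>2\<^sup>3 / f\<^sub>4\<close>. As the generating function is
  \<open>(f\<^sub>3\<^sup>3 / f\<^sub>1)\<^sup>2 (f\<^sub>6\<^sup>3 / f\<^sub>2)\<^sup>2\<close>, its odd part is \<open>2 q H\<close> with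
  \<open>H = f\<^sub>4\<^sup>2 f\<^sub>1\<^sub>2\<^sup>2 f\<^sub>6\<^sup>8 / f\<^sub>2\<^sup>4\<close>. Write \<open>\<phi>(-q) = f\<^sub>1\<^sup>2 / f\<^sub>2 = 1 + 2 S\<close>, where \<open>S\<close> is supported on
  the squares. Since \<open>\<phi>(-q)\<^sup>4\<close> is 1 modulo 8, \<open>H\<close> is
  \<open>f\<^sub>1\<^sub>2\<^sup>6 + 4 f\<^sub>2\<^sub>4\<^sup>3 (S(q\<^sup>2) + S(q\<^sup>2)\<^sup>2)\<close> modulo 8, and \<open>f\<^sub>1\<^sub>2\<^sup>6\<close> is \<open>f\<^sub>2\<^sub>4\<^sup>3\<close> modulo 2. The exponents
  that occur in these series then give the three congruences.
\<close>

section \<open>Infinite products and the q-binomial theorem\<close>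

definition qpoch :: "complex \<Rightarrow> complex \<Rightarrow> complex" where
  "qpoch z q = (\<Prod>n. 1 - z * q ^ n)"

lemma qpoch_convergent:
  fixes q :: complex
  assumes "norm q < 1"
  shows "convergent_prod (\<lambda>n. 1 - z * q ^ n)"
proof -
  have "summable (\<lambda>n. norm z * norm q ^ n)"
    by (rule summable_mult, rule summable_geometric) (use assms in simp)
  then have "summable (\<lambda>n. norm ((1 - z * q ^ n) - 1))"
    by (simp add: norm_mult norm_power)
  then show ?thesis
    by (intro abs_convergent_prod_imp_convergent_prod summable_imp_abs_convergent_prod)
qed

lemma qpoch_LIMSEQ:
  assumes "norm q < 1"
  shows "(\<lambda>N. \<Prod>k<N. 1 - z * q ^ k) \<longlonglongrightarrow> qpoch z q"
  using convergent_prod_LIMSEQ[OF qpoch_convergent[OF assms]]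
  unfolding qpoch_def LIMSEQ_lessThan_iff_atMost .

lemma qpoch_nonzero:
  assumes "norm q < 1" "norm z < 1"
  shows "qpoch z q \<noteq> 0"
proof -
  have "1 - z * q ^ n \<noteq> 0" for n
  proof -
    have "norm (q ^ n) \<le> 1"
      using assms by (simp add: norm_power power_le_one)
    then have "norm z * norm (q ^ n) \<le> norm z * 1"
      by (intro mult_left_mono) auto
    then have "norm (z * q ^ n) < 1"
      using assms by (simp add: norm_mult)
    then show ?thesis by force
  qed
  then show ?thesis
    unfolding qpoch_def using prodinf_nonzero[OF qpoch_convergent[OF assms(1)]] by blast
qed

lemma norm_power_less_one:
  fixes q :: complex
  assumes "norm q < 1" "m > 0"
  shows "norm (q ^ m) < 1"
  using assms by (simp add: norm_power power_less_one_iff)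

lemma prod_lessThan_mult2:
  fixes f :: "nat \<Rightarrow> 'a::comm_monoid_mult"
  shows "(\<Prod>k<2*N. f k) = (\<Prod>k<N. f (2 * k)) * (\<Prod>k<N. f (2 * k + 1))"
  by (induction N) (simp_all add: ac_simps)

lemma prod_lessThan_mult3:
  fixes f :: "nat \<Rightarrow> 'a::comm_monoid_mult"
  shows "(\<Prod>k<3*N. f k) = (\<Prod>k<N. f (3 * k)) * (\<Prod>k<N. f (3 * k + 1)) * (\<Prod>k<N. f (3 * k + 2))"
proof (induction N)
  case (Suc N)
  have *: "3 * Suc N = Suc (Suc (Suc (3 * N)))" by simp
  show ?case
    unfolding * prod.lessThan_Suc Suc.IH by (simp add: ac_simps)
qed simp

text \<open>The factors are sorted by the parity of the exponent. The partial products with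
  \<open>2 * N\<close> factors split exactly, and along this subsequence they still tend to
  \<open>qpoch z q\<close>.\<close>

lemma qpoch_split2:
  assumes "norm q < 1"
  shows "qpoch z q = qpoch z (q ^ 2) * qpoch (z * q) (q ^ 2)"
proof -
  have eq: "(\<Prod>k<2*N. 1 - z * q ^ k)
      = (\<Prod>k<N. 1 - z * (q ^ 2) ^ k) * (\<Prod>k<N. 1 - (z * q) * (q ^ 2) ^ k)" for N
  proof -
    have "z * q ^ (2 * k) = z * (q ^ 2) ^ k" for k
      by (simp add: power_mult)
    moreover have "z * q ^ (2 * k + 1) = z * q * (q ^ 2) ^ k" for k
      by (simp add: power_mult power_add power2_eq_square)
    ultimately show ?thesis
      by (simp only: prod_lessThan_mult2)
  qed
  have lim1: "(\<lambda>N. \<Prod>k<2*N. 1 - z * q ^ k) \<longlonglongrightarrow> qpoch z q"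
    by (rule filterlim_compose[OF qpoch_LIMSEQ[OF assms]])
      (auto intro: filterlim_subseq simp: strict_mono_def)
  have lim2: "(\<lambda>N. (\<Prod>k<N. 1 - z * (q ^ 2) ^ k) * (\<Prod>k<N. 1 - (z * q) * (q ^ 2) ^ k))
      \<longlonglongrightarrow> qpoch z (q ^ 2) * qpoch (z * q) (q ^ 2)"
    by (intro tendsto_mult qpoch_LIMSEQ norm_power_less_one assms) auto
  show ?thesis
    by (rule LIMSEQ_unique[OF lim1[unfolded eq] lim2])
qed

lemma qpoch_split3:
  assumes "norm q < 1"
  shows "qpoch z q = qpoch z (q ^ 3) * qpoch (z * q) (q ^ 3) * qpoch (z * q ^ 2) (q ^ 3)"
proof -
  have eq: "(\<Prod>k<3*N. 1 - z * q ^ k)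
      = (\<Prod>k<N. 1 - z * (q ^ 3) ^ k) * (\<Prod>k<N. 1 - (z * q) * (q ^ 3) ^ k)
        * (\<Prod>k<N. 1 - (z * q ^ 2) * (q ^ 3) ^ k)" for N
  proof -
    have "z * q ^ (3 * k) = z * (q ^ 3) ^ k" for k
      by (simp add: power_mult)
    moreover have "z * q ^ (3 * k + 1) = z * q * (q ^ 3) ^ k" for k
      by (simp add: power_mult power_add power2_eq_square)
    moreover have "z * q ^ (3 * k + 2) = z * q ^ 2 * (q ^ 3) ^ k" for k
      by (simp add: power_mult power_add power2_eq_square)
    ultimately show ?thesis
      by (simp only: prod_lessThan_mult3)
  qed
  have lim1: "(\<lambda>N. \<Prod>k<3*N. 1 - z * q ^ k) \<longlonglongrightarrow> qpoch z q"
    by (rule filterlim_compose[OF qpoch_LIMSEQ[OF assms]])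
      (auto intro: filterlim_subseq simp: strict_mono_def)
  have lim2: "(\<lambda>N. (\<Prod>k<N. 1 - z * (q ^ 3) ^ k) * (\<Prod>k<N. 1 - (z * q) * (q ^ 3) ^ k)
        * (\<Prod>k<N. 1 - (z * q ^ 2) * (q ^ 3) ^ k))
      \<longlonglongrightarrow> qpoch z (q ^ 3) * qpoch (z * q) (q ^ 3) * qpoch (z * q ^ 2) (q ^ 3)"
    by (intro tendsto_mult qpoch_LIMSEQ norm_power_less_one assms) auto
  show ?thesis
    by (rule LIMSEQ_unique[OF lim1[unfolded eq] lim2])
qed

text \<open>Factor by factor this is a difference of two squares; the partial products agree before
  the limit is taken.\<close>

lemma qpoch_mult_uminus:
  assumes "norm q < 1"
  shows "qpoch z q * qpoch (- z) q = qpoch (z ^ 2) (q ^ 2)"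
proof -
  have eq: "(\<Prod>k<N. 1 - z * q ^ k) * (\<Prod>k<N. 1 - (- z) * q ^ k) = (\<Prod>k<N. 1 - z ^ 2 * (q ^ 2) ^ k)" for N
    unfolding prod.distrib[symmetric]
    by (intro prod.cong) (simp_all add: algebra_simps power2_eq_square power_mult_distrib)
  have lim: "(\<lambda>N. (\<Prod>k<N. 1 - z * q ^ k) * (\<Prod>k<N. 1 - (- z) * q ^ k))
      \<longlonglongrightarrow> qpoch z q * qpoch (- z) q"
    by (intro tendsto_mult qpoch_LIMSEQ assms)
  show ?thesis
    by (rule LIMSEQ_unique[OF lim[unfolded eq] qpoch_LIMSEQ[OF norm_power_less_one[OF assms]]]) simp
qed

lemma qf_eq_qpoch: "qf m q = qpoch (q ^ m) (q ^ m)"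
  by (simp add: qf_def qpoch_def power_mult power_add)

lemma qf_nonzero: "norm q < 1 \<Longrightarrow> m > 0 \<Longrightarrow> qf m q \<noteq> 0"
  by (simp add: qf_eq_qpoch qpoch_nonzero norm_power_less_one)

section \<open>Finite products \<open>(q;q)_N\<close>, Gaussian binomials and the finite q-binomial
  theorem\<close>

definition qfac :: "nat \<Rightarrow> complex \<Rightarrow> complex" where
  "qfac N q = (\<Prod>k<N. 1 - q * q ^ k)"

lemma qfac_LIMSEQ: "norm q < 1 \<Longrightarrow> (\<lambda>N. qfac N q) \<longlonglongrightarrow> qpoch q q"
  unfolding qfac_def by (rule qpoch_LIMSEQ)

lemma qfac_Suc: "qfac (Suc N) q = qfac N q * (1 - q ^ Suc N)"
  by (simp add: qfac_def)

lemma qfac_nonzero: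
  assumes "norm q < 1"
  shows "qfac N q \<noteq> 0"
proof (induction N)
  case (Suc N)
  have "norm (q ^ Suc N) < 1"
    using assms norm_power_less_one by blast
  then have "1 - q ^ Suc N \<noteq> 0" by force
  with Suc show ?case by (simp only: qfac_Suc mult_eq_0_iff simp_thms)
qed (simp add: qfac_def)

text \<open>The value 0 for \<open>j > N\<close> keeps the Pascal rule valid at \<open>j = N\<close>
  and lets index shifts run one step past the end.\<close>

definition qbinom :: "nat \<Rightarrow> nat \<Rightarrow> complex \<Rightarrow> complex" where
  "qbinom N j q = (if j \<le> N then qfac N q / (qfac j q * qfac (N - j) q) else 0)"

lemma qbinom_0_right: "norm q < 1 \<Longrightarrow> qbinom N 0 q = 1"
  by (simp add: qbinom_def qfac_nonzero qfac_def[of 0])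

text \<open>Of the two q-Pascal rules this is the one that fits peeling off the last factor of a
  product. With \<open>x = q ^ Suc j\<close> and \<open>y = q ^ (N - j)\<close> it comes down to
  \<open>1 - x * y = (1 - y) + y * (1 - x)\<close>.\<close>

lemma qbinom_Suc_Suc:
  assumes "norm q < 1" "j \<le> N"
  shows "qbinom (Suc N) (Suc j) q = qbinom N (Suc j) q + q ^ (N - j) * qbinom N j q"
proof (cases "j = N")
  case True
  then show ?thesis
    using assms by (simp add: qbinom_def qfac_nonzero qfac_def[of 0])
next
  case False
  define d where "d = N - Suc j"
  have N: "N = j + Suc d"
    using assms False by (simp add: d_def)
  have nz: "qfac k q \<noteq> 0" "1 - q ^ Suc k \<noteq> 0" for k
    using qfac_nonzero[OF assms(1), of k] qfac_nonzero[OF assms(1), of "Suc k"]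
    unfolding qfac_Suc by auto
  have 1: "qbinom (Suc N) (Suc j) q
      = qfac N q * (1 - q ^ (Suc j + Suc d)) / (qfac j q * (1 - q ^ Suc j) * (qfac d q * (1 - q ^ Suc d)))"
    by (simp add: qbinom_def N qfac_Suc del: power_Suc)
  have 2: "qbinom N (Suc j) q = qfac N q / (qfac j q * (1 - q ^ Suc j) * qfac d q)"
    by (simp add: qbinom_def N qfac_Suc del: power_Suc)
  have 3: "qbinom N j q = qfac N q / (qfac j q * (qfac d q * (1 - q ^ Suc d)))"
    by (simp add: qbinom_def N qfac_Suc del: power_Suc)
  have "N - j = Suc d" by (simp add: N)
  define x where "x = q ^ Suc j"
  define y where "y = q ^ Suc d"
  have "1 - x \<noteq> 0" "1 - y \<noteq> 0" "q ^ (Suc j + Suc d) = x * y"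
    unfolding x_def y_def power_add using nz(2) by simp_all
  then show ?thesis
    unfolding 1 2 3 \<open>N - j = Suc d\<close> x_def[symmetric] y_def[symmetric]
    using nz(1)[of j] nz(1)[of d]
    by (simp add: divide_simps) (simp add: algebra_simps)
qed

text \<open>Induction on \<open>N\<close>, peeling off the last factor \<open>1 + z * q ^ N\<close>,
  so \<open>z\<close> stays fixed. The Pascal rule matches because
  \<open>(N - j) + (Suc j choose 2) = N + (j choose 2)\<close>.\<close>

lemma q_binomial_theorem:
  assumes "norm q < 1"
  shows "(\<Prod>k<N. 1 + z * q ^ k) = (\<Sum>j\<le>N. qbinom N j q * q ^ (j choose 2) * z ^ j)"
proof (induction N)
  case 0
  then show ?case by (simp add: qbinom_0_right assms binomial_eq_0)
next
  case (Suc N)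
  define t where "t N j = qbinom N j q * q ^ (j choose 2) * z ^ j" for N j
  have step: "t (Suc N) (Suc j) = t N (Suc j) + z * q ^ N * t N j" if "j \<le> N" for j
  proof -
    have "q ^ (N - j) * q ^ (Suc j choose 2) = q ^ N * q ^ (j choose 2)"
      using that by (simp add: power_add[symmetric] numeral_2_eq_2)
    then show ?thesis
      unfolding t_def qbinom_Suc_Suc[OF assms that] by (simp add: algebra_simps)
  qed
  have "(\<Sum>j\<le>Suc N. t (Suc N) j) = t (Suc N) 0 + (\<Sum>j\<le>N. t N (Suc j) + z * q ^ N * t N j)"
    unfolding sum.atMost_Suc_shift by (simp add: step)
  also have "\<dots> = (t N 0 + (\<Sum>j\<le>N. t N (Suc j))) + z * q ^ N * (\<Sum>j\<le>N. t N j)"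
    by (simp add: sum.distrib sum_distrib_left t_def qbinom_0_right assms)
  also have "t N 0 + (\<Sum>j\<le>N. t N (Suc j)) = (\<Sum>j\<le>N. t N j)"
    using sum.atMost_Suc_shift[of "t N" N] by (simp add: t_def qbinom_def)
  finally show ?case
    using Suc.IH unfolding t_def by (simp add: algebra_simps)
qed

section \<open>The Jacobi triple product\<close>

text \<open>The ratio of consecutive terms is \<open>r ^ n * w\<close>, which tends to 0 however
  large \<open>w\<close> is.\<close>

lemma summable_theta_nat:
  fixes r w :: real
  assumes "0 \<le> r" "r < 1" "w > 0"
  shows "summable (\<lambda>n. r ^ (n choose 2) * w ^ n)"
proof -
  have "(\<lambda>n. r ^ n * w) \<longlonglongrightarrow> 0 * w"
    using assms by (intro tendsto_mult LIMSEQ_power_zero) auto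
  then have "eventually (\<lambda>n. r ^ n * w < 1/2) sequentially"
    by (rule order_tendstoD) auto
  then obtain M where M: "\<And>n. n \<ge> M \<Longrightarrow> r ^ n * w < 1/2"
    by (auto simp: eventually_sequentially)
  show ?thesis
  proof (rule summable_ratio_test[of "1/2" M])
    fix n assume "n \<ge> M"
    have "r ^ (Suc n choose 2) * w ^ Suc n = (r ^ n * w) * (r ^ (n choose 2) * w ^ n)"
      by (simp add: numeral_2_eq_2 power_add)
    also have "\<dots> \<le> 1/2 * (r ^ (n choose 2) * w ^ n)"
      using M[OF \<open>n \<ge> M\<close>] assms by (intro mult_right_mono) auto
    finally show "norm (r ^ (Suc n choose 2) * w ^ Suc n) \<le> 1/2 * norm (r ^ (n choose 2) * w ^ n)"
      using assms by simp
  qed auto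
qed

text \<open>The binomial coefficient \<open>n choose 2\<close> continued to all integers. It is
  never negative, so it can serve as a natural exponent.\<close>

definition tri :: "int \<Rightarrow> nat" where
  "tri n = nat (n * (n - 1) div 2)"

lemma of_nat_tri: "2 * int (tri n) = n * (n - 1)"
proof -
  have "n * (n - 1) \<ge> 0"
    by (cases "n \<ge> 1") (auto simp: mult_nonpos_nonpos)
  moreover have "even (n * (n - 1))" by simp
  ultimately show ?thesis by (simp add: tri_def)
qed

lemma tri_eqI: "2 * int m = n * (n - 1) \<Longrightarrow> tri n = m"
  using of_nat_tri[of n] by linarith

lemma two_choose_two: "2 * int (n choose 2) = int n * (int n - 1)"
  by (induction n) (simp_all add: numeral_2_eq_2 algebra_simps)

lemma tri_of_nat: "tri (int n) = n choose 2"
  by (rule tri_eqI) (rule two_choose_two)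

lemma tri_minus: "tri (- int n) = Suc n choose 2"
  by (rule tri_eqI) (simp add: two_choose_two algebra_simps)

lemma summable_on_theta:
  fixes r w :: real
  assumes "0 \<le> r" "r < 1" "w > 0"
  shows "(\<lambda>n. r ^ tri n * w powi n) summable_on UNIV"
proof -
  let ?f = "\<lambda>n. r ^ tri n * w powi n"
  have "(\<lambda>n. r ^ (n choose 2) * w ^ n) summable_on UNIV"
    using assms by (intro norm_summable_imp_summable_on) (simp add: summable_theta_nat)
  then have "(?f \<circ> int) summable_on UNIV"
    by (simp add: o_def tri_of_nat)
  then have 1: "?f summable_on range int"
    by (subst summable_on_reindex) auto
  \<comment> \<open>The ray of nonpositive indices is the one-sided series at \<open>1 / w\<close>,
    shifted by one because \<open>tri (- int n)\<close> is \<open>Suc n choose 2\<close>; a factor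
    \<open>w\<close> then corrects the power.\<close>
  have "summable (\<lambda>n. r ^ (Suc n choose 2) * (1 / w) ^ Suc n)"
    using summable_theta_nat[of r "1 / w"] assms by (subst summable_Suc_iff) simp
  then have "(\<lambda>n. r ^ (Suc n choose 2) * (1 / w) ^ Suc n) summable_on UNIV"
    using assms by (intro norm_summable_imp_summable_on) simp
  then have "(\<lambda>n. w * (r ^ (Suc n choose 2) * (1 / w) ^ Suc n)) summable_on UNIV"
    by (rule summable_on_cmult_right)
  also have "(\<lambda>n. w * (r ^ (Suc n choose 2) * (1 / w) ^ Suc n)) = ?f \<circ> (\<lambda>n. - int n)"
    using assms by (auto simp: fun_eq_iff tri_minus power_int_minus field_simps)
  finally have 2: "?f summable_on range (\<lambda>n. - int n)"
    by (subst summable_on_reindex) (simp_all add: inj_def o_def)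
  have "range int \<union> range (\<lambda>n. - int n) = UNIV"
    by (auto simp: image_iff) (metis int_cases2)
  then show ?thesis
    using summable_on_union[OF 1 2] by simp
qed

text \<open>The q-binomial theorem with \<open>2 * M\<close> factors at \<open>z / q ^ M\<close>, so
  that the powers of \<open>q\<close> beside \<open>z\<close> run from \<open>-M\<close> to
  \<open>M - 1\<close>. Taking \<open>z / q ^ Suc k\<close> out of the factors with negative powers
  turns them into \<open>1 + q / z * q ^ k\<close>; the extracted constant \<open>c\<close> also
  appears on the series side and cancels.\<close>

lemma finite_triple_product:
  assumes "norm q < 1" "q \<noteq> 0" "z \<noteq> 0"
  shows "(\<Prod>k<M. 1 + z * q ^ k) * (\<Prod>k<M. 1 + q / z * q ^ k)
    = (\<Sum>n\<in>{- int M..int M}. qbinom (2 * M) (nat (n + int M)) q * (z powi n * q ^ tri n))"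
proof -
  define c where "c = z ^ M * (1 / q) ^ (Suc M choose 2)"
  have c: "c \<noteq> 0" using assms by (simp add: c_def)
  have "(\<Prod>k<M. (1 + z / q ^ M * q ^ k)) = (\<Prod>k<M. z / q ^ Suc k * (1 + q / z * q ^ k))"
  proof (subst prod.nat_diff_reindex[symmetric], intro prod.cong refl)
    fix k assume "k \<in> {..<M}"
    then have "q ^ M = q ^ (M - Suc k) * q ^ Suc k"
      by (simp add: power_add[symmetric] del: power_Suc)
    then show "1 + z / q ^ M * q ^ (M - Suc k) = z / q ^ Suc k * (1 + q / z * q ^ k)"
      using assms by (simp add: field_simps)
  qed
  also have "\<dots> = c * (\<Prod>k<M. 1 + q / z * q ^ k)"
  proof -
    have "(\<Prod>k<M. z / q ^ Suc k) = c"
      unfolding c_def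
      by (induction M) (simp_all add: numeral_2_eq_2 power_add power_divide ac_simps)
    then show ?thesis by (simp only: prod.distrib)
  qed
  finally have 1: "(\<Prod>k<M. 1 + z / q ^ M * q ^ k) = c * (\<Prod>k<M. 1 + q / z * q ^ k)" .
  have "(\<Prod>k<2*M. 1 + z / q ^ M * q ^ k)
      = (\<Prod>k<M. 1 + z / q ^ M * q ^ k) * (\<Prod>k<M. 1 + z / q ^ M * q ^ (M + k))"
  proof -
    have "(\<Prod>k<M + N. g k) = (\<Prod>k<M. g k) * (\<Prod>k<N. g (M + k))" for N and g :: "nat \<Rightarrow> complex"
      by (induction N) (simp_all add: ac_simps)
    then show ?thesis by (simp add: mult_2)
  qed
  also have "(\<Prod>k<M. 1 + z / q ^ M * q ^ (M + k)) = (\<Prod>k<M. 1 + z * q ^ k)"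
    using assms by (simp add: power_add)
  finally have 2: "(\<Prod>k<2*M. 1 + z / q ^ M * q ^ k)
      = c * ((\<Prod>k<M. 1 + z * q ^ k) * (\<Prod>k<M. 1 + q / z * q ^ k))"
    unfolding 1 by (simp add: ac_simps)
  have "(\<Prod>k<2*M. 1 + z / q ^ M * q ^ k)
      = (\<Sum>j\<le>2*M. qbinom (2*M) j q * q ^ (j choose 2) * (z / q ^ M) ^ j)"
    by (rule q_binomial_theorem) fact
  also have "\<dots> = (\<Sum>n\<in>{- int M..int M}.
      c * (qbinom (2 * M) (nat (n + int M)) q * (z powi n * q ^ tri n)))"
  proof (rule sum.reindex_bij_witness[of _ "\<lambda>n. nat (n + int M)" "\<lambda>j. int j - int M"])
    fix j assume "j \<in> {..2*M}"
    define n where "n = int j - int M"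
    \<comment> \<open>Recentring the quadratic exponent at \<open>j = M\<close>: the linear term
      \<open>M * j\<close> is absorbed by the denominator \<open>(q ^ M) ^ j\<close>, and the
      constant goes into \<open>c\<close>.\<close>
    have "int (j choose 2) + int (Suc M choose 2) = int (M * j) + int (tri n)"
      using two_choose_two[of j] two_choose_two[of "Suc M"] of_nat_tri[of n]
      by (simp add: n_def algebra_simps)
    then have e: "(j choose 2) + (Suc M choose 2) = M * j + tri n"
      by (simp only: of_nat_add[symmetric] of_nat_eq_iff)
    have zj: "z ^ j = z ^ M * z powi n"
    proof -
      have "z powi int j = z powi (int M + n)" by (simp add: n_def)
      also have "\<dots> = z powi int M * z powi n" using assms by (intro power_int_add) auto
      finally show ?thesis by simp
    qed
    have qj: "q ^ (j choose 2) / (q ^ M) ^ j = (1 / q) ^ (Suc M choose 2) * q ^ tri n"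
    proof -
      have "q ^ (j choose 2) * q ^ (Suc M choose 2) = (q ^ M) ^ j * q ^ tri n"
        unfolding power_mult[symmetric] power_add[symmetric] e ..
      then show ?thesis using assms by (simp add: field_simps)
    qed
    have "c * (qbinom (2 * M) (nat (n + int M)) q * (z powi n * q ^ tri n))
        = qbinom (2 * M) (nat (n + int M)) q * ((z ^ M * z powi n) * ((1 / q) ^ (Suc M choose 2) * q ^ tri n))"
      by (simp only: c_def mult_ac)
    also have "\<dots> = qbinom (2 * M) j q * q ^ (j choose 2) * (z / q ^ M) ^ j"
      unfolding zj[symmetric] qj[symmetric] by (simp add: n_def power_divide)
    finally show "c * (qbinom (2 * M) (nat (int j - int M + int M)) q
        * (z powi (int j - int M) * q ^ tri (int j - int M)))
      = qbinom (2*M) j q * q ^ (j choose 2) * (z / q ^ M) ^ j"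
      unfolding n_def .
  qed auto
  also have "\<dots> = c * (\<Sum>n\<in>{- int M..int M}. qbinom (2 * M) (nat (n + int M)) q * (z powi n * q ^ tri n))"
    by (simp add: sum_distrib_left)
  finally show ?thesis unfolding 2 using c by simp
qed

text \<open>The \<open>qfac N q\<close> converge to a nonzero limit, so they and their inverses are
  bounded. Uniformity in both indices provides the majorant for the passage to the limit.\<close>

lemma qbinom_bounded:
  assumes "norm q < 1"
  obtains K where "K \<ge> 0" "\<And>N j. norm (qbinom N j q) \<le> K"
proof -
  have E: "qpoch q q \<noteq> 0"
    using assms by (rule qpoch_nonzero) fact
  obtain B where B: "\<And>N. norm (qfac N q) \<le> B"
    using convergentI[OF qfac_LIMSEQ[OF assms]] Bseq_def convergent_imp_Bseq by metis
  have "(\<lambda>N. inverse (qfac N q)) \<longlonglongrightarrow> inverse (qpoch q q)"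
    by (intro tendsto_inverse qfac_LIMSEQ assms E)
  then obtain C where C: "\<And>N. norm (inverse (qfac N q)) \<le> C"
    using convergentI Bseq_def convergent_imp_Bseq by metis
  have pos: "B \<ge> 0" "C \<ge> 0"
    using norm_ge_zero B C by (meson order_trans)+
  show ?thesis
  proof (rule that[of "B * (C * C)"])
    fix N j
    have "norm (qfac N q * (inverse (qfac j q) * inverse (qfac (N - j) q))) \<le> B * (C * C)"
      unfolding norm_mult using pos by (intro mult_mono B C) auto
    then show "norm (qbinom N j q) \<le> B * (C * C)"
      using pos by (simp add: qbinom_def field_simps)
  qed (use pos in simp)
qed

text \<open>All three q-factorials tend to \<open>qpoch q q\<close>, one in the numerator and two in
  the denominator. Truncation by \<open>nat\<close> has no effect once \<open>M\<close> is at least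
  the absolute value of \<open>n\<close>.\<close>

lemma central_qbinom_LIMSEQ:
  assumes "norm q < 1"
  shows "(\<lambda>M. qbinom (2 * M) (nat (n + int M)) q) \<longlonglongrightarrow> 1 / qpoch q q"
proof -
  have E: "qpoch q q \<noteq> 0"
    using assms by (rule qpoch_nonzero) fact
  have sub: "(\<lambda>M. qfac (nat (m + int M)) q) \<longlonglongrightarrow> qpoch q q" for m
  proof (rule filterlim_compose[OF qfac_LIMSEQ[OF assms]])
    show "filterlim (\<lambda>M. nat (m + int M)) at_top sequentially"
      unfolding filterlim_at_top eventually_sequentially
    proof (intro allI)
      fix Z
      show "\<exists>N. \<forall>M\<ge>N. Z \<le> nat (m + int M)"
        by (rule exI[of _ "Z + nat \<bar>m\<bar>"]) auto
    qed
  qed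
  have "(\<lambda>M. qfac (2 * M) q) \<longlonglongrightarrow> qpoch q q"
    by (rule filterlim_compose[OF qfac_LIMSEQ[OF assms]])
      (auto intro: filterlim_subseq simp: strict_mono_def)
  then have "(\<lambda>M. qfac (2 * M) q / (qfac (nat (n + int M)) q * qfac (nat (- n + int M)) q))
      \<longlonglongrightarrow> qpoch q q / (qpoch q q * qpoch q q)"
    using E by (intro tendsto_divide tendsto_mult sub) auto
  moreover have "eventually (\<lambda>M. qfac (2 * M) q / (qfac (nat (n + int M)) q * qfac (nat (- n + int M)) q)
      = qbinom (2 * M) (nat (n + int M)) q) sequentially"
  proof (rule eventually_sequentiallyI[of "nat \<bar>n\<bar>"])
    fix M assume "M \<ge> nat \<bar>n\<bar>"
    then have "nat (n + int M) \<le> 2 * M" "2 * M - nat (n + int M) = nat (- n + int M)"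
      by auto
    then show "qfac (2 * M) q / (qfac (nat (n + int M)) q * qfac (nat (- n + int M)) q)
      = qbinom (2 * M) (nat (n + int M)) q"
      by (simp add: qbinom_def)
  qed
  ultimately show ?thesis
    using E by (simp add: tendsto_cong)
qed

text \<open>Tannery's theorem lets \<open>M\<close> tend to infinity in
  \<open>finite_triple_product\<close>: \<open>central_qbinom_LIMSEQ\<close> gives the termwise
  limits, and \<open>qbinom_bounded\<close> with \<open>summable_on_theta\<close> gives the
  majorant. The limit factor \<open>1 / qpoch q q\<close> is then moved to the product side.\<close>

theorem jacobi_triple_product:
  assumes "norm q < 1" "q \<noteq> 0" "z \<noteq> 0"
  shows "((\<lambda>n. z powi n * q ^ tri n) has_sum
    qpoch (- z) q * qpoch (- (q / z)) q * qpoch q q) UNIV"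
proof -
  define t where "t n = z powi n * q ^ tri n" for n
  define E where "E = qpoch q q"
  have E: "E \<noteq> 0"
    unfolding E_def using assms(1) by (rule qpoch_nonzero) fact
  \<comment> \<open>Tannery's theorem concerns series over the naturals, so the integers are
    enumerated by \<open>int_decode\<close> and each finite sum is padded with zeros.\<close>
  define a where "a k M = (if int_decode k \<in> {- int M..int M}
    then qbinom (2 * M) (nat (int_decode k + int M)) q * t (int_decode k) else 0)" for k M
  obtain K where K: "K \<ge> 0" "\<And>N j. norm (qbinom N j q) \<le> K"
    using qbinom_bounded[OF assms(1)] by blast
  have norm_t: "norm (t n) = norm q ^ tri n * norm z powi n" for n
    by (simp add: t_def norm_mult norm_power norm_power_int)
  have abs: "(\<lambda>n. norm (t n)) summable_on UNIV"
    unfolding norm_t using assms by (intro summable_on_theta) auto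
  then have "((\<lambda>n. norm (t n)) \<circ> int_decode) summable_on UNIV"
    by (subst summable_on_reindex[symmetric]) (auto simp: inj_int_decode surj_int_decode)
  then have summable: "summable (\<lambda>k. norm (t (int_decode k)))"
    by (simp add: summable_on_imp_summable o_def)
  have lim: "(\<lambda>M. \<Sum>k. a k M) \<longlonglongrightarrow> (\<Sum>k. t (int_decode k) / E)"
  proof (rule tannerys_theorem[THEN conjunct2, THEN conjunct2])
    fix k
    have "(\<lambda>M. qbinom (2 * M) (nat (int_decode k + int M)) q * t (int_decode k))
      \<longlonglongrightarrow> 1 / E * t (int_decode k)"
      unfolding E_def by (intro tendsto_mult tendsto_const central_qbinom_LIMSEQ assms)
    moreover have "eventually (\<lambda>M. qbinom (2 * M) (nat (int_decode k + int M)) q * t (int_decode k) = a k M)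
        sequentially"
      by (rule eventually_sequentiallyI[of "nat \<bar>int_decode k\<bar>"]) (auto simp: a_def)
    ultimately show "(\<lambda>M. a k M) \<longlonglongrightarrow> t (int_decode k) / E"
      by (simp add: tendsto_cong)
  next
    show "summable (\<lambda>k. K * norm (t (int_decode k)))"
      using summable by (rule summable_mult)
  next
    have "norm (a k M) \<le> K * norm (t (int_decode k))" for k M
      using K by (simp add: a_def norm_mult mult_right_mono)
    then show "eventually (\<lambda>(k, M). norm (a k M) \<le> K * norm (t (int_decode k))) (at_top \<times>\<^sub>F sequentially)"
      by (intro always_eventually) auto
  qed auto
  have "(\<Sum>k. a k M) = (\<Prod>k<M. 1 + z * q ^ k) * (\<Prod>k<M. 1 + q / z * q ^ k)" for M
  proof -
    have "(\<Sum>k. a k M) = (\<Sum>k\<in>int_encode ` {- int M..int M}. a k M)"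
    proof (rule suminf_finite)
      fix k assume "k \<notin> int_encode ` {- int M..int M}"
      then have "int_decode k \<notin> {- int M..int M}"
        using int_decode_inverse[of k] by (metis imageI)
      then show "a k M = 0" unfolding a_def by (simp only: if_False)
    qed simp
    also have "\<dots> = (\<Sum>n\<in>{- int M..int M}. a (int_encode n) M)"
      by (subst sum.reindex) (auto intro: inj_int_encode)
    also have "\<dots> = (\<Prod>k<M. 1 + z * q ^ k) * (\<Prod>k<M. 1 + q / z * q ^ k)"
      unfolding finite_triple_product[OF assms] by (intro sum.cong) (auto simp: a_def t_def)
    finally show ?thesis .
  qed
  with lim have "(\<lambda>M. (\<Prod>k<M. 1 - (- z) * q ^ k) * (\<Prod>k<M. 1 - (- (q / z)) * q ^ k))
      \<longlonglongrightarrow> (\<Sum>k. t (int_decode k) / E)"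
    by simp
  moreover have "(\<lambda>M. (\<Prod>k<M. 1 - (- z) * q ^ k) * (\<Prod>k<M. 1 - (- (q / z)) * q ^ k))
      \<longlonglongrightarrow> qpoch (- z) q * qpoch (- (q / z)) q"
    by (intro tendsto_mult qpoch_LIMSEQ assms)
  ultimately have eq: "(\<Sum>k. t (int_decode k) / E) = qpoch (- z) q * qpoch (- (q / z)) q"
    by (rule LIMSEQ_unique)
  have "((\<lambda>k. t (int_decode k)) has_sum (\<Sum>k. t (int_decode k))) UNIV"
    by (rule norm_summable_imp_has_sum[OF summable summable_sums[OF summable_norm_cancel[OF summable]]])
  then have "((t \<circ> int_decode) has_sum (\<Sum>k. t (int_decode k))) UNIV"
    by (simp add: o_def)
  then have "(t has_sum (\<Sum>k. t (int_decode k))) UNIV"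
    by (subst (asm) has_sum_reindex[symmetric]) (auto simp: inj_int_decode surj_int_decode)
  moreover have "(\<Sum>k. t (int_decode k)) = qpoch (- z) q * qpoch (- (q / z)) q * E"
    using eq E suminf_divide[OF summable_norm_cancel[OF summable], of E] by (simp add: field_simps)
  ultimately show ?thesis
    unfolding t_def E_def by simp
qed

section \<open>Theta functions as products\<close>

text \<open>In Ramanujan's notation this is \<open>f(z, q / z)\<close>.\<close>

definition theta :: "complex \<Rightarrow> complex \<Rightarrow> complex" where
  "theta z q = qpoch (- z) q * qpoch (- (q / z)) q * qpoch q q"

lemma qf_power: "qf m (q ^ k) = qf (k * m) q"
  by (simp add: qf_eq_qpoch power_mult)

lemma qpoch_odd: "norm q < 1 \<Longrightarrow> qpoch q (q ^ 2) * qf 2 q = qf 1 q"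
  using qpoch_split2[of q q] by (simp add: qf_eq_qpoch power2_eq_square)

text \<open>Changing the sign of \<open>q\<close> affects only the factors with odd exponent, and
  \<open>(q;q^2) (-q;q^2) = (q^2;q^4)\<close>. This later brings products at negative nomes back to
  quotients of \<open>qf m q\<close>.\<close>

lemma qf_uminus:
  assumes "norm q < 1"
  shows "qf 1 (- q) * qf 1 q * qf 4 q = qf 2 q ^ 3"
proof -
  have "qf 1 (- q) = qpoch (- q) (q ^ 2) * qf 2 q"
    using qpoch_split2[of "- q" "- q"] assms by (simp add: qf_eq_qpoch power2_eq_square)
  moreover have "qpoch q (q ^ 2) * qpoch (- q) (q ^ 2) = qpoch (q ^ 2) ((q ^ 2) ^ 2)"
    using assms by (intro qpoch_mult_uminus norm_power_less_one) auto
  moreover have "qpoch (q ^ 2) ((q ^ 2) ^ 2) * qf 4 q = qf 2 q"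
    using qpoch_odd[of "q ^ 2"] assms by (simp add: qf_power norm_power_less_one)
  moreover note qpoch_odd[OF assms]
  \<comment> \<open>The equations collected so far with every product replaced by a letter; what
    remains is elimination in a commutative ring. The proofs below end in the same way.\<close>
  moreover have "m = v * b \<Longrightarrow> u * v = w \<Longrightarrow> w * d = b \<Longrightarrow> u * b = a \<Longrightarrow> m * a * d = b ^ 3"
    for a b d m u v w :: complex
    by (clarify, simp add: eval_nat_numeral ac_simps)
  ultimately show ?thesis
    by blast
qed

text \<open>The residue classes modulo 3 together give all factors of \<open>qf 1 q\<close>.
  Combined with the triple product this is Euler's pentagonal number theorem.\<close>

lemma theta_pentagonal:
  assumes "norm q < 1" "q \<noteq> 0"
  shows "theta (- q) (q ^ 3) = qf 1 q"
proof -
  have "q ^ 3 / q = q ^ 2"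
    using assms by (simp add: field_simps eval_nat_numeral)
  moreover have "q * q ^ 2 = q ^ 3"
    by (simp add: eval_nat_numeral)
  ultimately show ?thesis
    using qpoch_split3[OF assms(1), of q] by (simp add: theta_def qf_eq_qpoch power2_eq_square)
qed

text \<open>The numbers in the name are the exponents of \<open>q\<close> in \<open>z\<close> and
  \<open>q / z\<close>, up to sign. Multiplying each of the two products by its twin of opposite
  sign leaves residues 2 and 4 modulo 6, which make up \<open>qf 2 q / qf 6 q\<close>.\<close>

lemma theta_1_2:
  assumes "norm q < 1" "q \<noteq> 0"
  shows "theta q (q ^ 3) * (qf 1 q * qf 6 q) = qf 2 q * qf 3 q ^ 2"
proof -
  have q3: "norm (q ^ 3) < 1" and q2: "norm (q ^ 2) < 1"
    using assms by (auto intro: norm_power_less_one)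
  have "q ^ 3 / q = q ^ 2"
    using assms by (simp add: field_simps eval_nat_numeral)
  then have "theta q (q ^ 3) = qpoch (- q) (q ^ 3) * qpoch (- (q ^ 2)) (q ^ 3) * qf 3 q"
    by (simp add: theta_def qf_eq_qpoch)
  moreover have "qpoch q (q ^ 3) * qpoch (- q) (q ^ 3) = qpoch (q ^ 2) (q ^ 6)"
    using qpoch_mult_uminus[OF q3, of q] by (simp flip: power_mult)
  moreover have "qpoch (q ^ 2) (q ^ 3) * qpoch (- (q ^ 2)) (q ^ 3) = qpoch (q ^ 4) (q ^ 6)"
    using qpoch_mult_uminus[OF q3, of "q ^ 2"] by (simp flip: power_mult)
  moreover have "qf 1 q = qpoch q (q ^ 3) * qpoch (q ^ 2) (q ^ 3) * qf 3 q"
    using qpoch_split3[OF assms(1), of q] by (simp add: qf_eq_qpoch flip: power_Suc power_Suc2 power2_eq_square power3_eq_cube)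
  moreover have "qf 2 q = qpoch (q ^ 2) (q ^ 6) * qpoch (q ^ 4) (q ^ 6) * qf 6 q"
    using qpoch_split3[OF q2, of "q ^ 2"] by (simp add: qf_eq_qpoch flip: power_mult power_add)
  moreover have "t = u' * v' * c \<Longrightarrow> u * u' = x \<Longrightarrow> v * v' = y \<Longrightarrow> a = u * v * c \<Longrightarrow> b = x * y * f
      \<Longrightarrow> t * (a * f) = b * c ^ 2" for a b c f t u u' v v' x y :: complex
    by (clarify, simp add: eval_nat_numeral ac_simps)
  ultimately show ?thesis
    by blast
qed

text \<open>Residues 1 and 3 modulo 4 exhaust the odd exponents. The function is Ramanujan's
  \<open>psi(-q)\<close>.\<close>

lemma theta_1_3:
  assumes "norm q < 1" "q \<noteq> 0"
  shows "theta (- q) (q ^ 4) * qf 2 q = qf 1 q * qf 4 q"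
proof -
  have q2: "norm (q ^ 2) < 1"
    using assms by (auto intro: norm_power_less_one)
  have "q ^ 4 / q = q ^ 3"
    using assms by (simp add: field_simps eval_nat_numeral)
  then have "theta (- q) (q ^ 4) = qpoch q (q ^ 4) * qpoch (q ^ 3) (q ^ 4) * qf 4 q"
    by (simp add: theta_def qf_eq_qpoch)
  moreover have "qpoch q (q ^ 2) = qpoch q (q ^ 4) * qpoch (q ^ 3) (q ^ 4)"
    using qpoch_split2[OF q2, of q] by (simp add: eval_nat_numeral mult.assoc)
  moreover note qpoch_odd[OF assms(1)]
  moreover have "t = u * v * d \<Longrightarrow> x = u * v \<Longrightarrow> x * b = a \<Longrightarrow> t * b = a * d" for a b d t u v x :: complex
    by (clarify, simp add: eval_nat_numeral ac_simps)
  ultimately show ?thesis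
    by blast
qed

text \<open>Residues 1 and 5 modulo 6 are the odd exponents with the odd multiples of 3
  removed.\<close>

lemma theta_1_5:
  assumes "norm q < 1" "q \<noteq> 0"
  shows "theta (- q) (q ^ 6) * (qf 2 q * qf 3 q) = qf 1 q * qf 6 q ^ 2"
proof -
  have q2: "norm (q ^ 2) < 1" and q3: "norm (q ^ 3) < 1"
    using assms by (auto intro: norm_power_less_one)
  have "q ^ 6 / q = q ^ 5"
    using assms by (simp add: field_simps eval_nat_numeral)
  then have "theta (- q) (q ^ 6) = qpoch q (q ^ 6) * qpoch (q ^ 5) (q ^ 6) * qf 6 q"
    by (simp add: theta_def qf_eq_qpoch)
  moreover have "qpoch q (q ^ 2) = qpoch q (q ^ 6) * qpoch (q ^ 3) (q ^ 6) * qpoch (q ^ 5) (q ^ 6)"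
    using qpoch_split3[OF q2, of q] by (simp add: eval_nat_numeral mult.assoc)
  moreover have "qpoch (q ^ 3) (q ^ 6) * qf 6 q = qf 3 q"
    using qpoch_odd[OF q3] by (simp add: qf_power flip: power_mult)
  moreover note qpoch_odd[OF assms(1)]
  moreover have "t = u * v * f \<Longrightarrow> x = u * w * v \<Longrightarrow> w * f = c \<Longrightarrow> x * b = a \<Longrightarrow> t * (b * c) = a * f ^ 2"
    for a b c f t u v w x :: complex
    by (clarify, simp add: eval_nat_numeral ac_simps)
  ultimately show ?thesis
    by blast
qed

text \<open>This is \<open>phi(-q)\<close>: here \<open>z\<close> and \<open>q / z\<close> coincide,
  and both products equal \<open>(q;q^2)\<close>.\<close>

lemma theta_1_1:
  assumes "norm q < 1" "q \<noteq> 0"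
  shows "theta (- q) (q ^ 2) * qf 2 q = qf 1 q ^ 2"
proof -
  have "theta (- q) (q ^ 2) = qpoch q (q ^ 2) * qpoch q (q ^ 2) * qf 2 q"
    using assms by (simp add: theta_def qf_eq_qpoch power2_eq_square)
  then show ?thesis
    unfolding qpoch_odd[OF assms(1), symmetric] by (simp add: power2_eq_square)
qed

lemma theta_has_sum:
  assumes "norm q < 1" "q \<noteq> 0" "z \<noteq> 0"
  shows "((\<lambda>n. z powi n * q ^ tri n) has_sum theta z q) UNIV"
  using jacobi_triple_product[OF assms] unfolding theta_def .

text \<open>Summability of complex families is absolute, so the double family is summable and may be
  summed in either order.\<close>

lemma has_sum_prod:
  fixes f :: "'a \<Rightarrow> complex" and g :: "'b \<Rightarrow> complex"
  assumes "(f has_sum a) A" "(g has_sum b) B"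
  shows "((\<lambda>(x, y). f x * g y) has_sum a * b) (A \<times> B)"
proof (rule has_sum_SigmaI)
  show "((\<lambda>y. case (x, y) of (x, y) \<Rightarrow> f x * g y) has_sum f x * b) B" for x
    using has_sum_cmult_right[OF assms(2)] by simp
  show "((\<lambda>x. f x * b) has_sum a * b) A"
    by (rule has_sum_cmult_left) fact
  have "(\<lambda>x. norm (f x)) summable_on A" "(\<lambda>y. norm (g y)) summable_on B"
    using assms has_sum_imp_summable summable_on_iff_abs_summable_on_complex by blast+
  then have "(\<lambda>p. norm (case p of (x, y) \<Rightarrow> f x * g y)) summable_on A \<times> B"
    by (intro Infinite_Sum.abs_summable_on_Sigma_iff[THEN iffD2])
      (auto simp: norm_mult infsum_cmult_right' infsum_nonneg
        intro: summable_on_cmult_right summable_on_cmult_left)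
  then show "(\<lambda>(x, y). f x * g y) summable_on A \<times> B"
    by (rule abs_summable_summable)
qed

section \<open>The 2-dissection\<close>

text \<open>A signed monomial \<open>(-1)^s q^e\<close>, kept as a pair of integers: products add
  the pairs, powers scale them, and comparing two terms becomes a parity check plus an equation of
  exponents.\<close>

definition smono :: "complex \<Rightarrow> int \<Rightarrow> int \<Rightarrow> complex" where
  "smono q s e = (if even s then 1 else -1) * q powi e"

lemma smono_mult: "q \<noteq> 0 \<Longrightarrow> smono q s e * smono q s' e' = smono q (s + s') (e + e')"
  by (simp add: smono_def power_int_add)

lemma smono_powi: "smono q s e powi n = smono q (s * n) (e * n)"
  by (cases "even s"; cases "even n")
    (simp_all add: smono_def power_int_mult power_int_minus_left flip: power_int_mult)

lemma smono_power: "smono q s e ^ n = smono q (s * int n) (e * int n)"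
  using smono_powi[of q s e "int n"] by simp

lemma smono_uminus: "- smono q s e = smono q (s + 1) e"
  by (simp add: smono_def)

lemma mult_smono: "q \<noteq> 0 \<Longrightarrow> q * smono q s e = smono q s (1 + e)"
  by (simp add: smono_def power_int_add)

lemma powi_eq_smono: "q powi n = smono q 0 n"
  by (simp add: smono_def)

lemma power_eq_smono: "q ^ numeral k = smono q 0 (numeral k)"
  by (simp add: smono_def)

lemma smono_cong: "even (s - s') \<Longrightarrow> e = e' \<Longrightarrow> smono q s e = smono q s' e'"
  by (auto simp: smono_def)

lemma tri_double: "int (tri (2 * u)) = u * (2 * u - 1)" "int (tri (2 * u + 1)) = u * (2 * u + 1)"
  using of_nat_tri[of "2 * u"] of_nat_tri[of "2 * u + 1"] by (simp_all add: algebra_simps)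

lemma even_tri_double: "even (tri (2 * u)) = even u" "even (tri (2 * u + 1)) = even u"
proof -
  have "even (int (tri (2 * u))) = even u" "even (int (tri (2 * u + 1))) = even u"
    unfolding tri_double by simp_all
  then show "even (tri (2 * u)) = even u" "even (tri (2 * u + 1)) = even u"
    by simp_all
qed

text \<open>
  With \<open>n = r - s\<close> and \<open>k = - r - s\<close> the quadratic form of the exponent becomes diagonal in \<open>r\<close> and \<open>s\<close>.
  Then \<open>n\<close> and \<open>k\<close> have the same parity, and this fixes which of the two indices \<open>k = - 2 l\<close> and
  \<open>k = 2 l - 1\<close> is used for a term \<open>l\<close> of the second factor. As the exponent has the parity of \<open>r\<close>,
  the cases \<open>r = 2 p\<close> and \<open>r = 1 - 2 p\<close> are its even and odd part.
\<close>

lemma dissection_terms: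
  fixes q :: complex
  assumes "q \<noteq> 0"
  defines "T \<equiv> \<lambda>n l. (q powi n * (q ^ 3) ^ tri n) * ((- (q ^ 3)) powi l * (q ^ 12) ^ tri l)"
  defines "b \<equiv> \<lambda>r s. if even (r - s) then (r + s) div 2 else (1 - r - s) div 2"
  shows "T (2 * p - s) (b (2 * p) s)
      = ((- (q ^ 8)) powi p * (q ^ 24) ^ tri p) * ((q ^ 2) powi s * (- (q ^ 6)) ^ tri s)" (is ?even)
    and "T (1 - 2 * p - s) (b (1 - 2 * p) s)
      = q * ((- (q ^ 4)) powi p * (q ^ 24) ^ tri p) * ((- (q ^ 2)) powi s * (- (q ^ 6)) ^ tri s)" (is ?odd)
proof -
  note to_smono = powi_eq_smono[of q] power_eq_smono[of q] smono_uminus smono_powi smono_power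
    smono_mult[OF assms(1)] mult_smono[OF assms(1)]
  have T: "T n l = smono q l (n + 3 * int (tri n) + 3 * l + 12 * int (tri l))" for n l
    unfolding T_def to_smono by (simp add: ac_simps)
  obtain u where u: "s = 2 * u \<or> s = 2 * u + 1"
    by (metis oddE evenE)
  \<comment> \<open>Doubled, the triangular exponents are polynomials, so the equalities of
    exponents below become polynomial identities once the parity of \<open>s\<close> is
    fixed.\<close>
  have tri: "2 * int (tri n) = n * (n - 1)" for n by (rule of_nat_tri)
  have *: "((- (q ^ 8)) powi p * (q ^ 24) ^ tri p) * ((q ^ 2) powi s * (- (q ^ 6)) ^ tri s)
      = smono q (p + int (tri s)) (8 * p + 24 * int (tri p) + 2 * s + 6 * int (tri s))"
    unfolding to_smono by (simp add: ac_simps)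
  have **: "q * ((- (q ^ 4)) powi p * (q ^ 24) ^ tri p) * ((- (q ^ 2)) powi s * (- (q ^ 6)) ^ tri s)
      = smono q (p + s + int (tri s)) (1 + 4 * p + 24 * int (tri p) + 2 * s + 6 * int (tri s))"
    unfolding to_smono by (simp add: ac_simps)
  show ?even
    unfolding T *
  proof (rule smono_cong)
    have b: "s = 2 * u \<and> b (2 * p) s = p + u \<or> s = 2 * u + 1 \<and> b (2 * p) s = - p - u"
      using u unfolding b_def by presburger
    then show "even (b (2 * p) s - (p + int (tri s)))"
      by (auto simp: even_tri_double)
    from b show "2 * p - s + 3 * int (tri (2 * p - s)) + 3 * b (2 * p) s + 12 * int (tri (b (2 * p) s))
      = 8 * p + 24 * int (tri p) + 2 * s + 6 * int (tri s)"
    proof (elim disjE conjE)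
      assume s: "s = 2 * u" and b: "b (2 * p) s = p + u"
      show ?thesis
        using tri[of "2 * p - s"] tri[of "b (2 * p) s"] tri[of p] tri[of s]
        unfolding b unfolding s by (simp add: algebra_simps)
    next
      assume s: "s = 2 * u + 1" and b: "b (2 * p) s = - p - u"
      show ?thesis
        using tri[of "2 * p - s"] tri[of "b (2 * p) s"] tri[of p] tri[of s]
        unfolding b unfolding s by (simp add: algebra_simps)
    qed
  qed
  show ?odd
    unfolding T **
  proof (rule smono_cong)
    have b: "s = 2 * u \<and> b (1 - 2 * p) s = p - u \<or> s = 2 * u + 1 \<and> b (1 - 2 * p) s = 1 - p + u"
      using u unfolding b_def by presburger
    then show "even (b (1 - 2 * p) s - (p + s + int (tri s)))"
      by (auto simp: even_tri_double)
    from b show "1 - 2 * p - s + 3 * int (tri (1 - 2 * p - s)) + 3 * b (1 - 2 * p) s + 12 * int (tri (b (1 - 2 * p) s))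
      = 1 + 4 * p + 24 * int (tri p) + 2 * s + 6 * int (tri s)"
    proof (elim disjE conjE)
      assume s: "s = 2 * u" and b: "b (1 - 2 * p) s = p - u"
      show ?thesis
        using tri[of "1 - 2 * p - s"] tri[of "b (1 - 2 * p) s"] tri[of p] tri[of s]
        unfolding b unfolding s by (simp add: algebra_simps)
    next
      assume s: "s = 2 * u + 1" and b: "b (1 - 2 * p) s = 1 - p + u"
      show ?thesis
        using tri[of "1 - 2 * p - s"] tri[of "b (1 - 2 * p) s"] tri[of p] tri[of s]
        unfolding b unfolding s by (simp add: algebra_simps)
    qed
  qed
qed

text \<open>The left side is a double series over \<open>(n, l)\<close>. It is reindexed by the
  bijection \<open>\<beta>\<close> and split by the parity of \<open>r\<close>; by
  \<open>dissection_terms\<close> each half factors again into two theta series.\<close>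

lemma theta_dissection:
  assumes "norm q < 1" "q \<noteq> 0"
  shows "theta q (q ^ 3) * theta (- (q ^ 3)) (q ^ 12)
    = theta (- (q ^ 8)) (q ^ 24) * theta (q ^ 2) (- (q ^ 6))
      + q * (theta (- (q ^ 4)) (q ^ 24) * theta (- (q ^ 2)) (- (q ^ 6)))"
proof -
  have lt: "norm (q ^ 3) < 1" "norm (q ^ 12) < 1" "norm (q ^ 24) < 1" "norm (- (q ^ 6)) < 1"
    using norm_power_less_one[OF assms(1)] by simp_all
  define T where "T = (\<lambda>(n, l). (q powi n * (q ^ 3) ^ tri n) * ((- (q ^ 3)) powi l * (q ^ 12) ^ tri l))"
  define b where "b r s = (if even (r - s) then (r + s) div 2 else (1 - r - s) div 2)" for r s :: int
  define \<beta> where "\<beta> = (\<lambda>(r, s). (r - s, b r s))"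
  \<comment> \<open>The inverse of \<open>\<beta>\<close>: solve \<open>r - s = n\<close> together
    with \<open>r + s = 2 * l\<close> for even \<open>n\<close>, or \<open>r + s = 1 - 2 * l\<close>
    for odd \<open>n\<close>.\<close>
  define \<gamma> where "\<gamma> = (\<lambda>(n :: int, l :: int). if even n then (l + n div 2, l - n div 2)
      else ((n + 1) div 2 - l, (1 - n) div 2 - l))"
  have \<gamma>\<beta>: "\<gamma> (\<beta> (r, s)) = (r, s)" for r s
  proof -
    obtain k where "r = s + 2 * k \<or> r = s + 2 * k + 1"
      by (metis add.assoc add_diff_cancel_left' diff_add_cancel add.commute evenE oddE)
    moreover have "b (s + 2 * k) s = s + k" "b (s + 2 * k + 1) s = - s - k"
      "(2 * k + 1) div 2 = k" "(2 * k + 1 + 1) div 2 = k + 1" "(1 - (2 * k + 1)) div 2 = - k"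
      unfolding b_def by presburger+
    ultimately show ?thesis
      by (auto simp: \<beta>_def \<gamma>_def)
  qed
  have \<beta>\<gamma>: "\<beta> (\<gamma> (n, l)) = (n, l)" for n l
  proof -
    obtain k where "n = 2 * k \<or> n = 2 * k + 1"
      by (metis evenE oddE)
    moreover have "b (l + k) (l - k) = l" "b (k + 1 - l) (- k - l) = l"
      "(2 * k + 1 + 1) div 2 = k + 1" "(1 - (2 * k + 1)) div 2 = - k"
      unfolding b_def by presburger+
    ultimately show ?thesis
      by (auto simp: \<beta>_def \<gamma>_def)
  qed
  have bij: "bij_betw \<beta> UNIV UNIV"
    by (rule bij_betwI[where g = \<gamma>]) (auto simp: \<beta>\<gamma> \<gamma>\<beta>)
  have T_even: "T (\<beta> (2 * p, s))
      = ((- (q ^ 8)) powi p * (q ^ 24) ^ tri p) * ((q ^ 2) powi s * (- (q ^ 6)) ^ tri s)" for p s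
    unfolding T_def \<beta>_def b_def prod.case by (rule dissection_terms(1)[OF assms(2)])
  have T_odd: "T (\<beta> (1 - 2 * p, s))
      = q * (((- (q ^ 4)) powi p * (q ^ 24) ^ tri p) * ((- (q ^ 2)) powi s * (- (q ^ 6)) ^ tri s))" for p s
    unfolding T_def \<beta>_def b_def prod.case
    using dissection_terms(2)[OF assms(2), of p s]
    by (simp only: mult.assoc)
  have "(T has_sum theta q (q ^ 3) * theta (- (q ^ 3)) (q ^ 12)) UNIV"
    unfolding T_def UNIV_Times_UNIV[symmetric]
    using lt assms by (intro has_sum_prod theta_has_sum) auto
  then have all: "((\<lambda>x. T (\<beta> x)) has_sum theta q (q ^ 3) * theta (- (q ^ 3)) (q ^ 12)) UNIV"
    by (simp add: has_sum_reindex_bij_betw[OF bij])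
  have "((\<lambda>(p, s). ((- (q ^ 8)) powi p * (q ^ 24) ^ tri p) * ((q ^ 2) powi s * (- (q ^ 6)) ^ tri s))
      has_sum theta (- (q ^ 8)) (q ^ 24) * theta (q ^ 2) (- (q ^ 6))) (UNIV \<times> UNIV)"
    using lt assms by (intro has_sum_prod theta_has_sum) auto
  then have "((\<lambda>x. T (\<beta> ((\<lambda>(p, s). (2 * p, s)) x))) has_sum
      theta (- (q ^ 8)) (q ^ 24) * theta (q ^ 2) (- (q ^ 6))) UNIV"
    by (simp add: T_even case_prod_unfold)
  then have even: "((\<lambda>x. T (\<beta> x)) has_sum theta (- (q ^ 8)) (q ^ 24) * theta (q ^ 2) (- (q ^ 6)))
      {x. even (fst x)}"
    by (subst (asm) has_sum_reindex_bij_betw[where g = "\<lambda>(p, s). (2 * p, s)" and B = "{x. even (fst x)}"])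
      (auto intro!: bij_betwI[where g = "\<lambda>(r, s). (r div 2, s)"] elim!: evenE)
  have "((\<lambda>(p, s). q * (((- (q ^ 4)) powi p * (q ^ 24) ^ tri p) * ((- (q ^ 2)) powi s * (- (q ^ 6)) ^ tri s)))
      has_sum q * (theta (- (q ^ 4)) (q ^ 24) * theta (- (q ^ 2)) (- (q ^ 6)))) (UNIV \<times> UNIV)"
    using has_sum_cmult_right[OF has_sum_prod[OF theta_has_sum theta_has_sum],
        of "q ^ 24" "- (q ^ 4)" "- (q ^ 6)" "- (q ^ 2)" q] lt assms
    by (simp add: case_prod_unfold)
  then have "((\<lambda>x. T (\<beta> ((\<lambda>(p, s). (1 - 2 * p, s)) x))) has_sum
      q * (theta (- (q ^ 4)) (q ^ 24) * theta (- (q ^ 2)) (- (q ^ 6)))) UNIV"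
    by (simp add: T_odd case_prod_unfold)
  then have odd: "((\<lambda>x. T (\<beta> x)) has_sum q * (theta (- (q ^ 4)) (q ^ 24) * theta (- (q ^ 2)) (- (q ^ 6))))
      {x. odd (fst x)}"
    by (subst (asm) has_sum_reindex_bij_betw[where g = "\<lambda>(p, s). (1 - 2 * p, s)" and B = "{x. odd (fst x)}"])
      (auto intro!: bij_betwI[where g = "\<lambda>(r, s). ((1 - r) div 2, s)"] elim!: oddE)
  have "{x :: int \<times> int. even (fst x)} \<union> {x. odd (fst x)} = UNIV" by auto
  with has_sum_Un_disjoint[OF even odd]
  have "((\<lambda>x. T (\<beta> x)) has_sum theta (- (q ^ 8)) (q ^ 24) * theta (q ^ 2) (- (q ^ 6))
      + q * (theta (- (q ^ 4)) (q ^ 24) * theta (- (q ^ 2)) (- (q ^ 6)))) UNIV"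
    by (simp add: disjoint_iff)
  with all show ?thesis
    by (rule has_sum_unique)
qed

text \<open>All six theta functions of \<open>theta_dissection\<close> are replaced by quotients of
  \<open>qf m q\<close>. Denominators are cleared so that the identity carries over to power series
  by sums and products alone.\<close>

theorem qf_3_1_dissection:
  assumes "norm q < 1" "q \<noteq> 0"
  shows "qf 3 q ^ 3 * qf 4 q * qf 2 q ^ 2 * qf 12 q
    = qf 1 q * (qf 4 q ^ 4 * qf 6 q ^ 2 + q * (qf 12 q ^ 4 * qf 2 q ^ 2))"
proof -
  note lt = norm_power_less_one[OF assms(1)]
  have m2: "norm (- (q ^ 2)) < 1" "- (q ^ 2) \<noteq> 0" and m6: "norm (q ^ 6) < 1"
    using lt[of 2] lt[of 6] assms by simp_all
  have nz: "qf 1 q \<noteq> 0" "qf 2 q \<noteq> 0" "qf 4 q \<noteq> 0" "qf 6 q \<noteq> 0" "qf 8 q \<noteq> 0" "qf 12 q \<noteq> 0" "qf 24 q \<noteq> 0"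
    using assms by (simp_all add: qf_nonzero)
  have t1: "theta q (q ^ 3) = qf 2 q * qf 3 q ^ 2 / (qf 1 q * qf 6 q)"
    using theta_1_2[OF assms] nz by (simp add: field_simps)
  have t2: "theta (- (q ^ 3)) (q ^ 12) = qf 3 q * qf 12 q / qf 6 q"
    using theta_1_3[of "q ^ 3"] lt[of 3] assms nz by (simp add: field_simps qf_power flip: power_mult)
  have t3: "theta (- (q ^ 8)) (q ^ 24) = qf 8 q"
    using theta_pentagonal[of "q ^ 8"] lt[of 8] assms by (simp add: qf_power flip: power_mult)
  \<comment> \<open>The nome \<open>- (q ^ 6)\<close> is the cube of \<open>- (q ^ 2)\<close>, so
    two of the theta functions are product formulas at a negative argument; \<open>v\<close> and
    \<open>w\<close> return them to the nome \<open>q\<close>.\<close>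
  have v: "qf 1 (- (q ^ 2)) = qf 4 q ^ 3 / (qf 2 q * qf 8 q)"
    using qf_uminus[of "q ^ 2"] lt[of 2] nz by (simp add: field_simps qf_power flip: numeral_2_eq_2)
  have w: "qf 1 (- (q ^ 6)) = qf 12 q ^ 3 / (qf 6 q * qf 24 q)"
    using qf_uminus[of "q ^ 6"] lt[of 6] nz by (simp add: field_simps qf_power flip: numeral_2_eq_2)
  have cube: "(- (q ^ 2)) ^ 3 = - (q ^ 6)"
    by (simp flip: power_mult)
  have t4: "theta (q ^ 2) (- (q ^ 6)) = qf 4 q ^ 3 / (qf 2 q * qf 8 q)"
    using theta_pentagonal[OF m2] by (simp add: cube v del: One_nat_def)
  have t5: "theta (- (q ^ 4)) (q ^ 24) = qf 4 q * qf 24 q ^ 2 / (qf 8 q * qf 12 q)"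
    using theta_1_5[of "q ^ 4"] lt[of 4] assms nz by (simp add: field_simps qf_power flip: power_mult)
  have even: "qf 6 (- (q ^ 2)) = qf 12 q" "qf 2 (- (q ^ 2)) = qf 4 q" and odd: "qf 3 (- (q ^ 2)) = qf 1 (- (q ^ 6))"
    by (simp_all add: qf_eq_qpoch cube flip: power_mult)
  have t6: "theta (- (q ^ 2)) (- (q ^ 6)) = qf 2 q * qf 8 q * qf 12 q ^ 5 / (qf 4 q ^ 2 * qf 6 q ^ 2 * qf 24 q ^ 2)"
    using theta_1_2[OF m2] nz unfolding cube even odd v w
    by (simp add: divide_simps) (simp add: eval_nat_numeral ac_simps)
  have even_part: "qf 8 q * (qf 4 q ^ 3 / (qf 2 q * qf 8 q)) = qf 4 q ^ 3 / qf 2 q"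
    using nz by simp
  have odd_part: "qf 4 q * qf 24 q ^ 2 / (qf 8 q * qf 12 q)
      * (qf 2 q * qf 8 q * qf 12 q ^ 5 / (qf 4 q ^ 2 * qf 6 q ^ 2 * qf 24 q ^ 2))
      = qf 2 q * qf 12 q ^ 4 / (qf 4 q * qf 6 q ^ 2)"
    using nz by (simp add: field_simps) (simp add: power_numeral_reduce)
  have main: "qf 2 q * qf 3 q ^ 2 / (qf 1 q * qf 6 q) * (qf 3 q * qf 12 q / qf 6 q)
      = qf 4 q ^ 3 / qf 2 q + q * (qf 2 q * qf 12 q ^ 4 / (qf 4 q * qf 6 q ^ 2))"
    using theta_dissection[OF assms] unfolding t1 t2 t3 t4 t5 t6 even_part odd_part .
  have "qf 3 q ^ 3 * qf 4 q * qf 2 q ^ 2 * qf 12 q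
      = qf 2 q * qf 3 q ^ 2 / (qf 1 q * qf 6 q) * (qf 3 q * qf 12 q / qf 6 q)
        * (qf 1 q * qf 6 q ^ 2 * qf 2 q * qf 4 q)"
    using nz by (simp add: field_simps power2_eq_square power3_eq_cube)
  also have "\<dots> = qf 1 q * (qf 4 q ^ 4 * qf 6 q ^ 2 + q * (qf 12 q ^ 4 * qf 2 q ^ 2))"
    unfolding main using nz by (simp add: field_simps) (simp add: power_numeral_reduce)
  finally show ?thesis .
qed

section \<open>Integer power series of analytic functions\<close>


text \<open>The point \<open>0\<close> is excluded, because the triple product identity divides by \<open>q\<close>.\<close>

definition represents :: "int fps \<Rightarrow> (complex \<Rightarrow> complex) \<Rightarrow> bool" where
  "represents X g \<longleftrightarrow> (\<forall>q. norm q < 1 \<longrightarrow> q \<noteq> 0 \<longrightarrow> (\<lambda>n. of_int (X $ n) * q ^ n) sums g q)"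

lemma represents_summable:
  fixes q :: complex
  assumes "represents X g" "norm q < 1"
  shows "summable (\<lambda>n. norm (of_int (X $ n) * q ^ n))"
proof (rule powser_insidea)
  \<comment> \<open>A real point halfway between \<open>norm q\<close> and 1: convergence there
    forces absolute convergence at \<open>q\<close>.\<close>
  define x :: complex where "x = of_real ((1 + norm q) / 2)"
  have "norm x = (1 + norm q) / 2"
    unfolding x_def norm_of_real by simp
  then have x: "norm x < 1" "norm q < norm x"
    using assms(2) by auto
  then show "norm q < norm x" by blast
  have "x \<noteq> 0" using x(2) by auto
  with x(1) show "summable (\<lambda>n. of_int (X $ n) * x ^ n)"
    using assms(1) unfolding represents_def by (blast intro: sums_summable)
qed

lemma represents_mult:
  assumes "represents X g" "represents Y h"
  shows "represents (X * Y) (\<lambda>q. g q * h q)"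
  unfolding represents_def
proof (intro allI impI)
  fix q :: complex assume q: "norm q < 1" "q \<noteq> 0"
  have "(\<lambda>k. \<Sum>i\<le>k. (of_int (X $ i) * q ^ i) * (of_int (Y $ (k - i)) * q ^ (k - i)))
      sums ((\<Sum>k. of_int (X $ k) * q ^ k) * (\<Sum>k. of_int (Y $ k) * q ^ k))"
    using assms q by (intro Cauchy_product_sums represents_summable)
  moreover have "(\<Sum>k. of_int (X $ k) * q ^ k) = g q" "(\<Sum>k. of_int (Y $ k) * q ^ k) = h q"
    using assms q unfolding represents_def by (blast intro: sums_unique[symmetric])+
  moreover have "(\<Sum>i\<le>k. (of_int (X $ i) * q ^ i) * (of_int (Y $ (k - i)) * q ^ (k - i)))
      = of_int ((X * Y) $ k) * q ^ k" for k
  proof -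
    have "of_int ((X * Y) $ k) * q ^ k = (\<Sum>i\<le>k. of_int (X $ i * Y $ (k - i)) * q ^ k)"
      by (simp add: fps_mult_nth atLeast0AtMost sum_distrib_right)
    also have "\<dots> = (\<Sum>i\<le>k. (of_int (X $ i) * q ^ i) * (of_int (Y $ (k - i)) * q ^ (k - i)))"
    proof (intro sum.cong refl)
      fix i assume "i \<in> {..k}"
      then have "q ^ k = q ^ i * q ^ (k - i)"
        by (simp flip: power_add)
      then show "of_int (X $ i * Y $ (k - i)) * q ^ k
          = (of_int (X $ i) * q ^ i) * (of_int (Y $ (k - i)) * q ^ (k - i))"
        by simp
    qed
    finally show ?thesis ..
  qed
  ultimately show "(\<lambda>n. of_int ((X * Y) $ n) * q ^ n) sums (g q * h q)"
    by simp
qed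

lemma represents_add:
  assumes "represents X g" "represents Y h"
  shows "represents (X + Y) (\<lambda>q. g q + h q)"
  using assms unfolding represents_def by (auto simp: ring_distribs intro!: sums_add)

lemma represents_1: "represents 1 (\<lambda>q. 1)"
  unfolding represents_def
proof (intro allI impI)
  fix q :: complex
  have "(\<lambda>n. of_int ((1 :: int fps) $ n) * q ^ n) = (\<lambda>n. if n = 0 then 1 else 0)"
    by auto
  then show "(\<lambda>n. of_int ((1 :: int fps) $ n) * q ^ n) sums 1"
    using sums_single[of 0 "\<lambda>_. 1 :: complex"] by simp
qed

lemma represents_fps_X: "represents fps_X (\<lambda>q. q)"
  unfolding represents_def
proof (intro allI impI)
  fix q :: complex
  have "(\<lambda>n. of_int ((fps_X :: int fps) $ n) * q ^ n) = (\<lambda>n. if n = 1 then q else 0)"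
    by auto
  then show "(\<lambda>n. of_int ((fps_X :: int fps) $ n) * q ^ n) sums q"
    using sums_single[of 1 "\<lambda>_. q"] by simp
qed

lemma represents_power: "represents X g \<Longrightarrow> represents (X ^ n) (\<lambda>q. g q ^ n)"
  by (induction n) (auto intro: represents_1 represents_mult)

lemma represents_compose_power:
  assumes "represents X g" "k > 0"
  shows "represents (X oo fps_X ^ k) (\<lambda>q. g (q ^ k))"
  unfolding represents_def
proof (intro allI impI)
  fix q :: complex assume q: "norm q < 1" "q \<noteq> 0"
  have "(\<lambda>n. of_int (X $ n) * (q ^ k) ^ n) sums g (q ^ k)"
    using assms q norm_power_less_one[of q k] unfolding represents_def by simp
  also have "(\<lambda>n. of_int (X $ n) * (q ^ k) ^ n)
      = (\<lambda>n. of_int ((X oo fps_X ^ k) $ (k * n)) * q ^ (k * n))"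
    using assms(2) by (simp add: fps_nth_compose_X_power power_mult)
  also have "\<dots> sums g (q ^ k) \<longleftrightarrow> (\<lambda>n. of_int ((X oo fps_X ^ k) $ n) * q ^ n) sums g (q ^ k)"
    using assms(2) by (intro sums_mono_reindex) (auto simp: strict_mono_def fps_nth_compose_X_power)
  finally show "(\<lambda>n. of_int ((X oo fps_X ^ k) $ n) * q ^ n) sums g (q ^ k)" .
qed

text \<open>The identity theorem for power series: it turns identities between functions on the
  punctured disc into identities in the ring of integer power series.\<close>

lemma represents_unique:
  assumes "represents X g" "represents Y h"
    and eq: "\<And>q. norm q < 1 \<Longrightarrow> q \<noteq> 0 \<Longrightarrow> g q = h q"
  shows "X = Y"
proof -
  define d where "d n = (of_int (X $ n - Y $ n) :: complex)" for n
  have sums: "(\<lambda>n. d n * q ^ n) sums 0" if "norm q < 1" "q \<noteq> 0" for q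
  proof -
    have "(\<lambda>n. of_int (X $ n) * q ^ n - of_int (Y $ n) * q ^ n) sums (g q - h q)"
      using assms(1,2) that unfolding represents_def by (intro sums_diff) auto
    then show ?thesis
      using eq[OF that] by (simp add: d_def ring_distribs)
  qed
  \<comment> \<open>The constant coefficient is recovered as a limit at 0, since the hypotheses
    speak of nonzero \<open>q\<close> only.\<close>
  have "((\<lambda>_ :: complex. 0) \<longlongrightarrow> d 0) (at 0)"
    by (rule powser_limit_0_strong[of 1]) (use sums in auto)
  then have d0: "d 0 = 0"
    using LIM_unique tendsto_const by metis
  have sums: "(\<lambda>n. d n * q ^ n) sums 0" if "norm q < 1" for q
    using sums[OF that] d0 powser_sums_zero[of d] by (cases "q = 0") auto
  have "Abs_fps d = 0"
  proof (rule eval_fps_eqD)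
    have "conv_radius d \<ge> 1"
      by (rule conv_radius_geI_ex) (metis sums sums_summable norm_of_real abs_of_pos less_ereal.simps(1) one_ereal_def)
    then have "conv_radius d > 0"
      by (rule less_le_trans[rotated]) simp
    then show "fps_conv_radius (Abs_fps d) > 0"
      by (simp add: fps_conv_radius_def)
    have "eventually (\<lambda>q :: complex. norm q < 1) (nhds 0)"
      using eventually_nhds_in_open[of "ball (0 :: complex) 1" 0] by simp
    then show "eventually (\<lambda>q. eval_fps (Abs_fps d) q = eval_fps 0 q) (nhds 0)"
      by eventually_elim (simp add: eval_fps_def sums_unique[OF sums, symmetric])
  qed auto
  then have "d n = 0" for n
    by (metis fps_nth_Abs_fps fps_zero_nth)
  then show ?thesis
    by (auto simp: d_def fps_eq_iff)
qed

text \<open>Terms are collected by exponent. Finite fibres make each collected coefficient a finite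
  sum of integers.\<close>

lemma represents_has_sum:
  fixes c :: "'i \<Rightarrow> int" and e :: "'i \<Rightarrow> nat"
  assumes fin: "\<And>n. finite {i \<in> A. e i = n}"
    and sum: "\<And>q. norm q < 1 \<Longrightarrow> q \<noteq> 0 \<Longrightarrow> ((\<lambda>i. of_int (c i) * q ^ e i) has_sum g q) A"
  shows "represents (Abs_fps (\<lambda>n. \<Sum>i\<in>{i \<in> A. e i = n}. c i)) g"
  unfolding represents_def
proof (intro allI impI)
  fix q :: complex assume q: "norm q < 1" "q \<noteq> 0"
  have bij: "bij_betw (\<lambda>i. (e i, i)) A (SIGMA n:UNIV. {i \<in> A. e i = n})"
    by (rule bij_betwI[where g = snd]) auto
  have "((\<lambda>(n, i). of_int (c i) * q ^ n) has_sum g q) (SIGMA n:UNIV. {i \<in> A. e i = n})"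
    using sum[OF q] by (subst has_sum_reindex_bij_betw[OF bij, symmetric]) simp
  then have "((\<lambda>n. \<Sum>i\<in>{i \<in> A. e i = n}. of_int (c i) * q ^ n) has_sum g q) UNIV"
    by (rule has_sum_SigmaD) (auto intro!: has_sum_finiteI fin)
  then have "(\<lambda>n. \<Sum>i\<in>{i \<in> A. e i = n}. of_int (c i) * q ^ n) sums g q"
    by (rule has_sum_imp_sums)
  then show "(\<lambda>n. of_int (Abs_fps (\<lambda>n. \<Sum>i\<in>{i \<in> A. e i = n}. c i) $ n) * q ^ n) sums g q"
    by (simp add: sum_distrib_right)
qed

section \<open>Integer series for \<open>qf 1\<close> and for \<open>phi(-q)\<close>\<close>

lemma abs_le_mult_self_int: "\<bar>n\<bar> \<le> n * (n :: int)"
proof (cases "n = 0")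
  case False
  then have "\<bar>n\<bar> * 1 \<le> \<bar>n\<bar> * \<bar>n\<bar>"
    by (intro mult_left_mono) auto
  then show ?thesis by simp
qed simp

lemma finite_nat_eq_abs_le:
  assumes "\<And>n :: int. \<bar>n\<bar> \<le> f n"
  shows "finite {n \<in> A. nat (f n) = N}"
proof (rule finite_subset)
  show "{n \<in> A. nat (f n) = N} \<subseteq> {- int N..int N}"
  proof
    fix n assume "n \<in> {n \<in> A. nat (f n) = N}"
    then have "\<bar>n\<bar> \<le> int N" using assms[of n] by auto
    then show "n \<in> {- int N..int N}" by auto
  qed
qed simp

lemma theta_term:
  fixes q :: complex
  assumes "q \<noteq> 0" "n + int k * int (tri n) \<ge> 0"
  shows "(- q) powi n * (q ^ k) ^ tri n
    = of_int (if even n then 1 else -1) * q ^ nat (n + int k * int (tri n))"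
proof -
  have "q ^ nat (n + int k * int (tri n)) = q powi (n + int k * int (tri n))"
    using assms(2) by (simp add: power_int_def)
  also have "\<dots> = q powi n * q powi (int (k * tri n))"
    using assms(1) by (simp add: power_int_add)
  also have "q powi (int (k * tri n)) = (q ^ k) ^ tri n"
    by (simp only: power_int_of_nat power_mult)
  finally show ?thesis
    by (simp add: power_int_minus_left)
qed

text \<open>The coefficients come from Euler's pentagonal series. Constant term 1 is what makes
  \<open>P\<close> invertible over the integers.\<close>

lemma qf_1_represented: "\<exists>P. represents P (qf 1) \<and> P $ 0 = 1"
proof -
  define c where "c n = (if even n then 1 else -1 :: int)" for n :: int
  \<comment> \<open>The generalized pentagonal numbers \<open>n * (3 * n - 1) / 2\<close>.\<close>
  define e where "e n = n + int 3 * int (tri n)" for n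
  have e: "\<bar>n\<bar> \<le> e n" for n
    using of_nat_tri[of n] abs_le_mult_self_int[of n] by (simp add: e_def algebra_simps)
  have "represents (Abs_fps (\<lambda>N. \<Sum>n\<in>{n \<in> UNIV. nat (e n) = N}. c n)) (qf 1)"
  proof (rule represents_has_sum)
    fix q :: complex assume q: "norm q < 1" "q \<noteq> 0"
    have "(- q) powi n * (q ^ 3) ^ tri n = of_int (c n) * q ^ nat (e n)" for n
      using theta_term[OF q(2), of n 3] e[of n] unfolding c_def e_def by fastforce
    then show "((\<lambda>n. of_int (c n) * q ^ nat (e n)) has_sum qf 1 q) UNIV"
      using theta_has_sum[of "q ^ 3" "- q"] theta_pentagonal[OF q] norm_power_less_one[OF q(1), of 3] q
      by simp
  qed (rule finite_nat_eq_abs_le[OF e])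
  moreover have "{n \<in> UNIV. nat (e n) = 0} = {0}"
  proof -
    have "nat (e 0) = 0"
      by (simp add: e_def tri_def)
    moreover have "n = 0" if "nat (e n) = 0" for n
      using e[of n] that by linarith
    ultimately show ?thesis by blast
  qed
  then have "Abs_fps (\<lambda>N. \<Sum>n\<in>{n \<in> UNIV. nat (e n) = N}. c n) $ 0 = 1"
    by (simp add: c_def)
  ultimately show ?thesis by blast
qed

text \<open>In the series of \<open>(-1)^n q^(n^2)\<close> the indices \<open>n\<close> and
  \<open>- n\<close> contribute equally. Pairing them gives the factor 2, and \<open>S\<close> keeps
  the positive \<open>n\<close>.\<close>

lemma theta_1_1_represented:
  "\<exists>S. represents (1 + 2 * S) (\<lambda>q. theta (- q) (q ^ 2)) \<and> (\<forall>n. S $ n \<noteq> 0 \<longrightarrow> (\<exists>j. n = j ^ 2))"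
proof -
  define c where "c n = (if even n then 1 else -1 :: int)" for n :: int
  define W where "W q = (\<Sum>\<^sub>\<infinity>n\<in>{0<..}. of_int (c n) * q ^ nat (n * n))" for q :: complex
  define S where "S = Abs_fps (\<lambda>N. \<Sum>n\<in>{n \<in> {0<..}. nat (n * n) = N}. c n)"
  have theta: "((\<lambda>n. of_int (c n) * q ^ nat (n * n)) has_sum theta (- q) (q ^ 2)) UNIV"
    if q: "norm q < 1" "q \<noteq> 0" for q
  proof -
    have "n + int 2 * int (tri n) = n * n" for n
      using of_nat_tri[of n] by (simp add: algebra_simps)
    then have "(- q) powi n * (q ^ 2) ^ tri n = of_int (c n) * q ^ nat (n * n)" for n
      using theta_term[OF q(2), of n 2] unfolding c_def by simp
    then show ?thesis
      using theta_has_sum[of "q ^ 2" "- q"] norm_power_less_one[OF q(1), of 2] q by simp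
  qed
  have W: "((\<lambda>n. of_int (c n) * q ^ nat (n * n)) has_sum W q) {0<..}"
    if q: "norm q < 1" "q \<noteq> 0" for q
    unfolding W_def using theta[OF q]
    by (intro has_sum_infsum summable_on_subset_banach[OF has_sum_imp_summable]) auto
  have S: "represents S W"
    unfolding S_def by (intro represents_has_sum W finite_nat_eq_abs_le abs_le_mult_self_int)
  have "theta (- q) (q ^ 2) = 1 + (W q + W q)" if q: "norm q < 1" "q \<noteq> 0" for q
  proof -
    let ?f = "\<lambda>n. of_int (c n) * q ^ nat (n * n)"
    have "bij_betw uminus {..<0 :: int} {0<..}"
      by (rule bij_betwI[where g = uminus]) auto
    from has_sum_reindex_bij_betw[OF this, of ?f] have "(?f has_sum W q) {..<0}"
      using W[OF q] by (simp add: c_def)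
    then have nonzero: "(?f has_sum W q + W q) ({..<0} \<union> {0<..})"
      by (rule has_sum_Un_disjoint[OF _ W[OF q]]) auto
    have zero: "(?f has_sum 1) {0}"
      by (rule has_sum_finiteI) (auto simp: c_def)
    have "(?f has_sum 1 + (W q + W q)) ({0} \<union> ({..<0} \<union> {0<..}))"
      by (rule has_sum_Un_disjoint[OF zero nonzero]) auto
    moreover have "{0} \<union> ({..<0 :: int} \<union> {0<..}) = UNIV" by auto
    ultimately show ?thesis
      using theta[OF q] by (metis has_sum_unique)
  qed
  then have "represents (1 + (S + S)) (\<lambda>q. theta (- q) (q ^ 2))"
    using represents_add[OF represents_1 represents_add[OF S S]] unfolding represents_def by simp
  moreover have "\<exists>j. n = j ^ 2" if "S $ n \<noteq> 0" for n
  proof -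
    have "{m \<in> {0<..}. nat (m * m) = n} \<noteq> {}"
      using that unfolding S_def fps_nth_Abs_fps by (metis (no_types, lifting) sum.empty)
    then obtain m :: int where "m > 0" "nat (m * m) = n" by blast
    then have "n = nat m ^ 2" by (simp add: nat_mult_distrib power2_eq_square)
    then show ?thesis by blast
  qed
  ultimately show ?thesis
    by (metis mult_2)
qed

section \<open>The congruences\<close>

text \<open>Division is modelled by the inverses \<open>I\<close>. The dissection reads
  \<open>F3 ^ 3 * I1 = E + x * Q\<close>, and \<open>C\<close> is its square times
  \<open>F6 ^ 6 * I2 ^ 2\<close>. The cross term \<open>2 * x * E * Q\<close> becomes the odd part
  once the remaining series are even.\<close>

lemma odd_part_decomposition:
  fixes C x F1 F2 F3 F4 F6 F12 I1 I2 I4 I12 :: "'a :: comm_ring_1"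
  assumes inv: "F1 * I1 = 1" "F2 * I2 = 1" "F4 * I4 = 1" "F12 * I12 = 1"
    and C: "C * (F1 ^ 2 * F2 ^ 2) = F3 ^ 6 * F6 ^ 6"
    and dissection: "F3 ^ 3 * F4 * F2 ^ 2 * F12 = F1 * (F4 ^ 4 * F6 ^ 2 + x * (F12 ^ 4 * F2 ^ 2))"
  shows "C = ((F4 ^ 3 * F6 ^ 2 * I2 ^ 2 * I12) ^ 2 + x ^ 2 * (F12 ^ 3 * I4) ^ 2) * (F6 ^ 6 * I2 ^ 2)
    + 2 * (x * (F4 ^ 2 * F12 ^ 2 * F6 ^ 8 * I2 ^ 4))"
proof -
  define E where "E = F4 ^ 3 * F6 ^ 2 * I2 ^ 2 * I12"
  define Q where "Q = F12 ^ 3 * I4"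
  have "F3 ^ 3 * I1 = F3 ^ 3 * I1 * (F4 * I4) * (F2 * I2) ^ 2 * (F12 * I12)"
    by (simp add: inv)
  also have "\<dots> = (F3 ^ 3 * F4 * F2 ^ 2 * F12) * (I1 * I4 * I2 ^ 2 * I12)"
    by (simp add: power_mult_distrib ac_simps)
  also have "\<dots> = (F1 * I1) * ((F4 * I4) * E + x * ((F12 * I12) * (F2 * I2) ^ 2 * Q))"
    unfolding dissection E_def Q_def by (simp add: power_mult_distrib power_numeral_reduce algebra_simps)
  finally have A: "F3 ^ 3 * I1 = E + x * Q"
    by (simp add: inv)
  have "C = C * ((F1 * I1) ^ 2 * (F2 * I2) ^ 2)"
    by (simp add: inv)
  also have "\<dots> = (C * (F1 ^ 2 * F2 ^ 2)) * (I1 ^ 2 * I2 ^ 2)"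
    by (simp add: power_mult_distrib ac_simps)
  also have "\<dots> = (F3 ^ 3 * I1) ^ 2 * (F6 ^ 6 * I2 ^ 2)"
    unfolding C by (simp add: power_mult_distrib ac_simps flip: power_mult)
  also have "\<dots> = (E ^ 2 + x ^ 2 * Q ^ 2) * (F6 ^ 6 * I2 ^ 2) + 2 * (x * (E * Q * F6 ^ 6 * I2 ^ 2))"
    unfolding A by (simp add: power2_eq_square algebra_simps)
  also have "E * Q * F6 ^ 6 * I2 ^ 2 = (F4 * I4) * (F12 * I12) * (F4 ^ 2 * F12 ^ 2 * F6 ^ 8 * I2 ^ 4)"
    unfolding E_def Q_def by (simp add: power_numeral_reduce ac_simps)
  also have "\<dots> = F4 ^ 2 * F12 ^ 2 * F6 ^ 8 * I2 ^ 4"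
    by (simp add: inv)
  finally show ?thesis unfolding E_def Q_def .
qed

text \<open>Since \<open>(1 + 2 s)\<^sup>4\<close> is congruent to \<open>1\<close> modulo \<open>8\<close>, all the quotients
  \<open>f\<^sub>m\<^sup>2 / f\<^sub>2\<^sub>m = \<phi>(-q\<^sup>m)\<close> can be eliminated.\<close>

lemma odd_part_mod_8:
  fixes F2 F4 F6 F12 F24 I2 S2 S6 S12 :: "'a :: comm_ring_1"
  assumes inv: "F2 * I2 = 1"
    and phi: "(1 + 2 * S2) * F4 = F2 ^ 2" "(1 + 2 * S6) * F12 = F6 ^ 2" "(1 + 2 * S12) * F24 = F12 ^ 2"
  defines "H \<equiv> F4 ^ 2 * F12 ^ 2 * F6 ^ 8 * I2 ^ 4"
  obtains V W where "H = F12 ^ 6 + 4 * (F24 ^ 3 * (S2 + S2 ^ 2)) + 8 * W" "F12 ^ 6 = F24 ^ 3 + 2 * V"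
proof -
  define R where "R s = s + 3 * s ^ 2 + 4 * s ^ 3 + 2 * s ^ 4" for s :: 'a
  have R: "(1 + 2 * s) ^ 4 = 1 + 8 * R s" for s
    by (simp add: R_def power_numeral_reduce algebra_simps)
  define Z where "Z = S2 + S2 ^ 2"
  have Z: "(1 + 2 * S2) ^ 2 = 1 + 4 * Z"
    by (simp add: Z_def power2_eq_square algebra_simps)
  define V where "V = F24 ^ 3 * (3 * S12 + 6 * S12 ^ 2 + 4 * S12 ^ 3)"
  have "F12 ^ 6 = (F12 ^ 2) ^ 3"
    by (simp flip: power_mult)
  also have "\<dots> = F24 ^ 3 + 2 * V"
    unfolding phi(3)[symmetric] V_def by (simp add: power_numeral_reduce algebra_simps)
  finally have V: "F12 ^ 6 = F24 ^ 3 + 2 * V" .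
  \<comment> \<open>The factor \<open>(1 + 2 * S2) ^ 2\<close> turns \<open>F4 ^ 2\<close> into
    \<open>F2 ^ 4\<close>, which cancels \<open>I2 ^ 4\<close>, while \<open>F6 ^ 8\<close> is the
    fourth power of \<open>(1 + 2 * S6) * F12\<close>.\<close>
  have "(1 + 2 * S2) ^ 2 * H = ((1 + 2 * S2) * F4) ^ 2 * F12 ^ 2 * (F6 ^ 2) ^ 4 * I2 ^ 4"
    unfolding H_def by (simp add: power_mult_distrib ac_simps flip: power_mult)
  also have "\<dots> = (F2 * I2) ^ 4 * F12 ^ 2 * ((1 + 2 * S6) * F12) ^ 4"
    unfolding phi by (simp add: power_mult_distrib ac_simps flip: power_mult)
  also have "\<dots> = F12 ^ 6 * (1 + 2 * S6) ^ 4"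
    by (simp add: inv power_mult_distrib ac_simps flip: power_add mult.assoc)
  finally have H: "(1 + 2 * S2) ^ 2 * H = F12 ^ 6 * (1 + 2 * S6) ^ 4" .
  \<comment> \<open>A second factor \<open>(1 + 2 * S2) ^ 2\<close> completes the fourth power on
    the left, which is 1 modulo 8, and leaves \<open>1 + 4 * Z\<close> on the right.\<close>
  have "(1 + 2 * S2) ^ 4 * H = (1 + 2 * S2) ^ 2 * (F12 ^ 6 * (1 + 2 * S6) ^ 4)"
    unfolding H[symmetric] by (simp flip: power_add mult.assoc)
  then have "(1 + 8 * R S2) * H = (1 + 4 * Z) * (F12 ^ 6 * (1 + 8 * R S6))"
    unfolding R Z .
  then have "H = (1 + 4 * Z) * (F12 ^ 6 * (1 + 8 * R S6)) - 8 * (R S2 * H)"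
    by (simp add: algebra_simps)
  also have "\<dots> = F12 ^ 6 + 4 * (Z * F12 ^ 6) + 8 * ((1 + 4 * Z) * (F12 ^ 6 * R S6) - R S2 * H)"
    by (simp add: algebra_simps)
  \<comment> \<open>Modulo 8 only the parity of \<open>F12 ^ 6\<close> matters here. Replacing it by
    \<open>F24 ^ 3\<close> gains support on multiples of 24, hence of 8.\<close>
  also have "4 * (Z * F12 ^ 6) = 4 * (F24 ^ 3 * Z) + 8 * (Z * V)"
    unfolding V by (simp add: algebra_simps)
  finally have "H = F12 ^ 6 + 4 * (F24 ^ 3 * Z) + 8 * (Z * V + ((1 + 4 * Z) * (F12 ^ 6 * R S6) - R S2 * H))"
    by (simp add: algebra_simps)
  with V show ?thesis
    using that unfolding Z_def by blast
qed

section \<open>Supports of power series\<close>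

lemma fps_mult_nth_nonzeroE:
  fixes X Y :: "'a :: semiring_0 fps"
  assumes "(X * Y) $ n \<noteq> 0"
  obtains i j where "n = i + j" "X $ i \<noteq> 0" "Y $ j \<noteq> 0"
proof -
  obtain i where "i \<in> {0..n}" "X $ i * Y $ (n - i) \<noteq> 0"
    using assms unfolding fps_mult_nth by (rule sum.not_neutral_contains_not_neutral)
  then have "n = i + (n - i)" "X $ i \<noteq> 0" "Y $ (n - i) \<noteq> 0"
    by auto
  then show ?thesis
    by (rule that)
qed

text \<open>Expresses that \<open>X\<close> is a power series in \<open>fps_X ^ k\<close>.\<close>

definition supp_dvd :: "nat \<Rightarrow> int fps \<Rightarrow> bool" where
  "supp_dvd k X \<longleftrightarrow> (\<forall>n. X $ n \<noteq> 0 \<longrightarrow> k dvd n)"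

lemma supp_dvdD: "supp_dvd k X \<Longrightarrow> \<not> k dvd n \<Longrightarrow> X $ n = 0"
  unfolding supp_dvd_def by blast

lemma supp_dvd_mult:
  assumes "supp_dvd k X" "supp_dvd k Y"
  shows "supp_dvd k (X * Y)"
  unfolding supp_dvd_def
proof (intro allI impI)
  fix n assume "(X * Y) $ n \<noteq> 0"
  then obtain i j where "n = i + j" "X $ i \<noteq> 0" "Y $ j \<noteq> 0"
    by (rule fps_mult_nth_nonzeroE)
  with assms show "k dvd n"
    unfolding supp_dvd_def by auto
qed

lemma supp_dvd_add:
  assumes "supp_dvd k X" "supp_dvd k Y"
  shows "supp_dvd k (X + Y)"
  unfolding supp_dvd_def
proof (intro allI impI)
  fix n assume "(X + Y) $ n \<noteq> 0"
  then have "X $ n \<noteq> 0 \<or> Y $ n \<noteq> 0" by auto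
  with assms show "k dvd n"
    unfolding supp_dvd_def by blast
qed

lemma supp_dvd_1: "supp_dvd k 1"
  by (simp add: supp_dvd_def)

lemma supp_dvd_power: "supp_dvd k X \<Longrightarrow> supp_dvd k (X ^ m)"
  by (induction m) (simp_all add: supp_dvd_1 supp_dvd_mult)

lemma supp_dvd_compose: "k dvd m \<Longrightarrow> supp_dvd k (X oo fps_X ^ m)"
  unfolding supp_dvd_def fps_nth_compose_X_power using dvd_trans by (simp split: if_split) blast

lemma supp_dvd_fps_X_power: "supp_dvd k (fps_X ^ k)"
  unfolding supp_dvd_def fps_X_power_nth by simp

theorem theorem3p6:
  fixes CP3 :: "nat \<Rightarrow> int"
  assumes "\<And>q :: complex. norm q < 1 \<Longrightarrow>
    (\<lambda>n. of_int (CP3 n) * q ^ n) sums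
      ((qf 3 q ^ 6 * qf 6 q ^ 6) / (qf 1 q ^ 2 * qf 2 q ^ 2))"
  shows "\<forall>n. [CP3 (24 * n + 7) = 0] (mod 16) \<and>
             [CP3 (24 * n + 13) = 0] (mod 4) \<and>
             [CP3 (24 * n + 19) = 0] (mod 8)"
proof -

  \<comment> \<open>Transfer of the analytic identities to integer power series\<close>
  obtain P where P: "represents P (qf 1)" "P $ 0 = 1"
    using qf_1_represented by blast
  obtain S where S: "represents (1 + 2 * S) (\<lambda>q. theta (- q) (q ^ 2))" "\<And>n. S $ n \<noteq> 0 \<Longrightarrow> \<exists>j. n = j ^ 2"
    using theta_1_1_represented by blast
  \<comment> \<open>\<open>F k\<close> is the series of \<open>qf k\<close>, \<open>I k\<close> its
    inverse, and \<open>1 + 2 * T k\<close> the series of \<open>phi(-q^k)\<close>.\<close>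
  define F where "F k = P oo fps_X ^ k" for k
  define I where "I k = fps_right_inverse P 1 oo fps_X ^ k" for k
  define T where "T k = S oo fps_X ^ k" for k
  have F: "represents (F k) (qf k)" if "k > 0" for k
  proof -
    have "(\<lambda>q. qf 1 (q ^ k)) = qf k"
      by (simp add: fun_eq_iff qf_power)
    with represents_compose_power[OF P(1) that] show ?thesis by (simp only: F_def)
  qed
  have inv: "F k * I k = 1" if "k > 0" for k
  proof -
    have "F k * I k = (P * fps_right_inverse P 1) oo fps_X ^ k"
      unfolding F_def I_def using that by (intro fps_compose_mult_distrib[symmetric]) simp
    also have "P * fps_right_inverse P 1 = 1"
      using P(2) by (intro fps_right_inverse) simp
    finally show ?thesis by simp
  qed
  have phi: "(1 + 2 * T k) * F (2 * k) = F k ^ 2" if "k > 0" for k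
  proof (rule represents_unique)
    have "(1 + 2 * S) oo fps_X ^ k = 1 + 2 * T k"
      unfolding T_def mult_2 by (simp only: fps_compose_add_distrib fps_compose_1)
    then show "represents ((1 + 2 * T k) * F (2 * k)) (\<lambda>q. theta (- (q ^ k)) ((q ^ k) ^ 2) * qf (2 * k) q)"
      using represents_mult[OF represents_compose_power[OF S(1) that] F[of "2 * k"]] that by simp
    show "represents (F k ^ 2) (\<lambda>q. qf k q ^ 2)"
      using that by (intro represents_power F)
    show "theta (- (q ^ k)) ((q ^ k) ^ 2) * qf (2 * k) q = qf k q ^ 2" if "norm q < 1" "q \<noteq> 0" for q
      using theta_1_1[of "q ^ k"] norm_power_less_one[of q k] that \<open>k > 0\<close>
      by (simp add: qf_power mult.commute)
  qed
  define C where "C = Abs_fps CP3"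
  have C: "C * (F 1 ^ 2 * F 2 ^ 2) = F 3 ^ 6 * F 6 ^ 6"
  proof (rule represents_unique)
    have "represents C (\<lambda>q. (qf 3 q ^ 6 * qf 6 q ^ 6) / (qf 1 q ^ 2 * qf 2 q ^ 2))"
      unfolding represents_def C_def using assms by simp
    then show "represents (C * (F 1 ^ 2 * F 2 ^ 2))
        (\<lambda>q. (qf 3 q ^ 6 * qf 6 q ^ 6) / (qf 1 q ^ 2 * qf 2 q ^ 2) * (qf 1 q ^ 2 * qf 2 q ^ 2))"
      by (intro represents_mult represents_power F) auto
    show "represents (F 3 ^ 6 * F 6 ^ 6) (\<lambda>q. qf 3 q ^ 6 * qf 6 q ^ 6)"
      by (intro represents_mult represents_power F) auto
  qed (simp add: qf_nonzero)
  have dissection: "F 3 ^ 3 * F 4 * F 2 ^ 2 * F 12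
      = F 1 * (F 4 ^ 4 * F 6 ^ 2 + fps_X * (F 12 ^ 4 * F 2 ^ 2))"
  proof (rule represents_unique)
    show "represents (F 3 ^ 3 * F 4 * F 2 ^ 2 * F 12) (\<lambda>q. qf 3 q ^ 3 * qf 4 q * qf 2 q ^ 2 * qf 12 q)"
      by (intro represents_mult represents_power F) auto
    show "represents (F 1 * (F 4 ^ 4 * F 6 ^ 2 + fps_X * (F 12 ^ 4 * F 2 ^ 2)))
        (\<lambda>q. qf 1 q * (qf 4 q ^ 4 * qf 6 q ^ 2 + q * (qf 12 q ^ 4 * qf 2 q ^ 2)))"
      by (intro represents_mult represents_add represents_power represents_fps_X F) auto
  qed (rule qf_3_1_dissection)
  define H where "H = F 4 ^ 2 * F 12 ^ 2 * F 6 ^ 8 * I 2 ^ 4"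
  define E where "E = ((F 4 ^ 3 * F 6 ^ 2 * I 2 ^ 2 * I 12) ^ 2 + fps_X ^ 2 * (F 12 ^ 3 * I 4) ^ 2) * (F 6 ^ 6 * I 2 ^ 2)"
  have C_eq: "C = E + 2 * (fps_X * H)"
    unfolding E_def H_def by (rule odd_part_decomposition[OF inv inv inv inv C dissection]) simp_all
  have inv2: "F 2 * I 2 = 1"
    by (rule inv) simp
  have phi': "(1 + 2 * T 2) * F 4 = F 2 ^ 2" "(1 + 2 * T 6) * F 12 = F 6 ^ 2"
    "(1 + 2 * T 12) * F 24 = F 12 ^ 2"
    using phi[of 2] phi[of 6] phi[of 12] by simp_all
  obtain V W where HW: "H = F 12 ^ 6 + 4 * (F 24 ^ 3 * (T 2 + T 2 ^ 2)) + 8 * W"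
    and V: "F 12 ^ 6 = F 24 ^ 3 + 2 * V"
    by (rule odd_part_mod_8[OF inv2 phi', folded H_def])

  \<comment> \<open>\<open>E\<close> is built from \<open>fps_X ^ 2\<close> and from
    \<open>F k\<close>, \<open>I k\<close> with even \<open>k\<close>. Odd coefficients of
    \<open>C\<close> therefore come from \<open>2 * (fps_X * H)\<close> alone, where
    \<open>fps_X\<close> shifts the index by one.\<close>
  have "supp_dvd 2 E"
    unfolding E_def F_def I_def
    by (intro supp_dvd_mult supp_dvd_add supp_dvd_power[OF supp_dvd_mult] supp_dvd_power[OF supp_dvd_compose]
        supp_dvd_power[OF supp_dvd_power[OF supp_dvd_compose]] supp_dvd_fps_X_power supp_dvd_compose) simp_all
  then have coeff: "CP3 l = 2 * H $ m" if "l = Suc m" "even m" for l m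
  proof -
    have "E $ Suc m = 0"
      using \<open>supp_dvd 2 E\<close> by (rule supp_dvdD) (use that in simp)
    then have "C $ Suc m = 2 * H $ m"
      unfolding C_eq by (simp add: numeral_fps_const)
    then show ?thesis by (simp add: C_def \<open>l = Suc m\<close>)
  qed

  \<comment> \<open>Vanishing coefficients from residues of the exponents\<close>
  have F12: "(F 12 ^ 6) $ m = 0" if "\<not> 12 dvd m" for m
    unfolding F_def by (intro supp_dvdD[OF supp_dvd_power[OF supp_dvd_compose[OF dvd_refl]]] that)
  have F24_supp: "supp_dvd 24 (F 24 ^ 3)"
    unfolding F_def by (intro supp_dvd_power supp_dvd_compose dvd_refl)
  \<comment> \<open>The exponents are \<open>2 * j ^ 2\<close>, and a square is 0 or 1 modulo
    4.\<close>
  have T2: "n mod 8 = 0 \<or> n mod 8 = 2" if nz: "T 2 $ n \<noteq> 0" for n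
  proof -
    have "2 dvd n" "S $ (n div 2) \<noteq> 0"
      using nz unfolding T_def fps_nth_compose_X_power by (auto split: if_splits)
    then obtain j where n: "n = 2 * j ^ 2"
      using S(2) by fastforce
    have "j mod 4 \<in> {0, 1, 2, 3}" by auto
    then have "(j mod 4) ^ 2 mod 4 \<in> {0, 1}" by auto
    then have square: "j ^ 2 mod 4 = 0 \<or> j ^ 2 mod 4 = 1" by (simp add: power_mod)
    have "2 * x mod 8 = 0 \<or> 2 * x mod 8 = 2" if "x mod 4 = 0 \<or> x mod 4 = 1" for x :: nat
      using that by presburger
    from this[OF square] show ?thesis unfolding n .
  qed
  have T2sq: "n mod 8 = 0 \<or> n mod 8 = 2 \<or> n mod 8 = 4" if nz: "(T 2 ^ 2) $ n \<noteq> 0" for n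
  proof -
    obtain i j where "n = i + j" "T 2 $ i \<noteq> 0" "T 2 $ j \<noteq> 0"
      using nz unfolding power2_eq_square by (rule fps_mult_nth_nonzeroE)
    then have "i mod 8 = 0 \<or> i mod 8 = 2" "j mod 8 = 0 \<or> j mod 8 = 2"
      using T2 by blast+
    moreover have "n mod 8 = (i mod 8 + j mod 8) mod 8"
      by (simp only: \<open>n = i + j\<close> mod_add_eq)
    ultimately show ?thesis by auto
  qed
  \<comment> \<open>Exponents of \<open>F 24 ^ 3\<close> vanish modulo 8, so only the residues 0, 2
    and 4 of \<open>T 2 + T 2 ^ 2\<close> can occur.\<close>
  have FT: "(F 24 ^ 3 * (T 2 + T 2 ^ 2)) $ m = 0" if m: "m mod 8 = 6" for m
  proof (rule ccontr)
    assume "(F 24 ^ 3 * (T 2 + T 2 ^ 2)) $ m \<noteq> 0"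
    then obtain i j where ij: "m = i + j" "(F 24 ^ 3) $ i \<noteq> 0" "(T 2 + T 2 ^ 2) $ j \<noteq> 0"
      by (rule fps_mult_nth_nonzeroE)
    have "24 dvd i" using F24_supp ij(2) unfolding supp_dvd_def by blast
    then obtain k where "i = 24 * k" by blast
    then have "m mod 8 = (8 * (3 * k) + j) mod 8"
      using ij(1) by simp
    then have "m mod 8 = j mod 8"
      by (simp only: mod_mult_self4)
    moreover have "T 2 $ j \<noteq> 0 \<or> (T 2 ^ 2) $ j \<noteq> 0" using ij(3) by auto
    then have "j mod 8 = 0 \<or> j mod 8 = 2 \<or> j mod 8 = 4"
      using T2[of j] T2sq[of j] by blast
    ultimately show False using m by simp
  qed
  show ?thesis
  proof (intro allI conjI)
    fix n :: nat
    \<comment> \<open>The index is 6 modulo 12 and 6 modulo 8, so both leading terms of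
      \<open>HW\<close> vanish and 8 divides the coefficient of \<open>H\<close>. The factor 2 in
      \<open>coeff\<close> gives 16.\<close>
    have "\<not> 12 dvd 24 * n + 6"
      using dvd_add_right_iff[of 12 "24 * n" 6] by simp
    moreover have "(8 * (3 * n) + 6) mod 8 = (6 :: nat)"
      unfolding mod_mult_self4 by simp
    ultimately have "H $ (24 * n + 6) = 8 * W $ (24 * n + 6)"
      unfolding HW using F12[of "24 * n + 6"] FT[of "24 * n + 6"] by (simp add: numeral_fps_const)
    then show "[CP3 (24 * n + 7) = 0] (mod 16)"
      using coeff[of "24 * n + 7" "24 * n + 6"] by (simp add: cong_0_iff)
    \<comment> \<open>Here \<open>F 12 ^ 6\<close> may contribute, but it is \<open>F 24 ^ 3\<close>
      modulo 2, and 24 does not divide the index.\<close>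
    have "H $ (24 * n + 12) = 2 * (V + 2 * (F 24 ^ 3 * (T 2 + T 2 ^ 2)) + 4 * W) $ (24 * n + 12)"
    proof -
      have "\<not> 24 dvd 24 * n + 12"
        using dvd_add_right_iff[of 24 "24 * n" 12] by simp
      then have "(F 24 ^ 3) $ (24 * n + 12) = 0"
        using F24_supp unfolding supp_dvd_def by blast
      then show ?thesis unfolding HW V by (simp add: numeral_fps_const)
    qed
    then show "[CP3 (24 * n + 13) = 0] (mod 4)"
      using coeff[of "24 * n + 13" "24 * n + 12"] by (simp add: cong_0_iff)
    \<comment> \<open>The index is 2 modulo 8, so the term with factor 4 may survive; only
      \<open>F 12 ^ 6\<close> is excluded.\<close>
    have "\<not> 12 dvd 24 * n + 18"
      using dvd_add_right_iff[of 12 "24 * n" 18] by simp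
    then have "H $ (24 * n + 18) = 4 * (F 24 ^ 3 * (T 2 + T 2 ^ 2) + 2 * W) $ (24 * n + 18)"
      unfolding HW using F12[of "24 * n + 18"] by (simp add: numeral_fps_const)
    then show "[CP3 (24 * n + 19) = 0] (mod 8)"
      using coeff[of "24 * n + 19" "24 * n + 18"] by (simp add: cong_0_iff)
  qed
qed

end
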